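(* For arbitrary non-negative integers $a, b$, there exists a finite simple connected graph $G$ such that $\operatorname{ind-match}(G) = \operatorname{reg}(S/I(G)) - a$ and $\operatorname{min-match}(G) = \operatorname{reg}(S/I(G)) + b$.
   Context: For a finite simple graph $G$ on vertex set $V$, $S = K[V]$ is the polynomial ring over a field $K$ with one variable for each vertex and standard grading, and the edge ideal $I(G)$ is generated by the monomials $xy$ with $\{x, y\} \in E(G)$. For a graded $S$-module $N$, $\operatorname{reg}(N) = \max\{ j - i : \beta_{ij}(N) \neq 0 \}$ where $\beta_{ij}(N) = \dim_K [\operatorname{Tor}_i^S(K, N)]_j$. A matching is a set of pairwise disjoint edges; maximal if no edge can be added; $\operatorname{min-match}(G)$ is the minimum cardinality of a maximal matching. Two edges $e,e'$ are $3$-disjoint if $e \cap e' = \emptyset$ and no edge meets both; an induced matching is a set of pairwise $3$-disjoint edges, and $\operatorname{ind-match}(G)$ is the maximum cardinality of an induced matching. *)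

theory Defs
  imports
    "HOL-Library.Poly_Mapping"
    "HOL-Algebra.QuotRing"
    "Jordan_Normal_Form.VS_Connect"
begin

hide_const (open) Multiset.mult Polynomial.smult

section \<open>Graphs and matchings\<close>

definition fin_simple_graph :: "'v set \<Rightarrow> 'v set set \<Rightarrow> bool" where
  "fin_simple_graph V E \<longleftrightarrow> finite V \<and> (\<forall>e\<in>E. e \<subseteq> V \<and> card e = 2)"

text \<open>The graph without vertices is not counted as connected.\<close>

definition connected_graph :: "'v set \<Rightarrow> 'v set set \<Rightarrow> bool" where
  "connected_graph V E \<longleftrightarrow> V \<noteq> {} \<and> (\<forall>u\<in>V. \<forall>v\<in>V. (u, v) \<in> {(x, y). {x, y} \<in> E}\<^sup>*)"

definition is_matching :: "'v set set \<Rightarrow> 'v set set \<Rightarrow> bool" where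
  "is_matching E M \<longleftrightarrow> M \<subseteq> E \<and> pairwise disjnt M"

definition maximal_matching :: "'v set set \<Rightarrow> 'v set set \<Rightarrow> bool" where
  "maximal_matching E M \<longleftrightarrow> is_matching E M \<and> (\<forall>e\<in>E - M. \<not> is_matching E (insert e M))"

definition three_disjoint :: "'v set set \<Rightarrow> 'v set \<Rightarrow> 'v set \<Rightarrow> bool" where
  "three_disjoint E e e' \<longleftrightarrow> e \<inter> e' = {} \<and> \<not> (\<exists>f\<in>E. f \<inter> e \<noteq> {} \<and> f \<inter> e' \<noteq> {})"

definition induced_matching :: "'v set set \<Rightarrow> 'v set set \<Rightarrow> bool" where
  "induced_matching E M \<longleftrightarrow> M \<subseteq> E \<and> pairwise (three_disjoint E) M"

definition min_match :: "'v set set \<Rightarrow> nat" where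
  "min_match E = Min (card ` {M. maximal_matching E M})"

definition ind_match :: "'v set set \<Rightarrow> nat" where
  "ind_match E = Max (card ` {M. induced_matching E M})"


section \<open>Graded modules over polynomial rings\<close>

text \<open>
  A graded module carries its homogeneous components, indexed by the integers. The fields
  \<open>mult\<close> and \<open>one\<close>, which the HOL-Algebra record of modules inherits from rings, play no role
  for modules; for a ring regarded as a module over itself they hold its multiplication and unit.
\<close>

record ('r, 'm) graded_module = "('r, 'm) module" +
  grade :: "int \<Rightarrow> 'm set"

type_synonym ('v, 'k) mpoly = "('v \<Rightarrow>\<^sub>0 nat) \<Rightarrow>\<^sub>0 'k"

definition mon_degree :: "('v \<Rightarrow>\<^sub>0 nat) \<Rightarrow> nat" where
  "mon_degree m = (\<Sum>x\<in>Poly_Mapping.keys m. Poly_Mapping.lookup m x)"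

definition mvar :: "'v \<Rightarrow> ('v, 'k::field) mpoly" where
  "mvar x = Poly_Mapping.single (Poly_Mapping.single x 1) 1"

definition mconst :: "'k::field \<Rightarrow> ('v, 'k) mpoly" where
  "mconst c = Poly_Mapping.single 0 c"

definition polys_in :: "'v set \<Rightarrow> ('v, 'k::field) mpoly set" where
  "polys_in V = {p. \<forall>m\<in>Poly_Mapping.keys p. Poly_Mapping.keys m \<subseteq> V}"

text \<open>The polynomial ring \<open>S = K[V]\<close> with the standard grading, also as a module over itself.\<close>

definition poly_ring :: "'v set \<Rightarrow> (('v, 'k::field) mpoly, ('v, 'k) mpoly) graded_module" where
  "poly_ring V = \<lparr>carrier = polys_in V, mult = (*), one = 1, zero = 0, add = (+), smult = (*),
     grade = (\<lambda>j. {p \<in> polys_in V. \<forall>m\<in>Poly_Mapping.keys p. int (mon_degree m) = j})\<rparr>"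

text \<open>
  The field \<open>K\<close> as the graded \<open>S\<close>-module \<open>S / (x | x \<in> V)\<close>, concentrated in degree 0.
\<close>

definition residue_field :: "(('v, 'k::field) mpoly, 'k) graded_module" where
  "residue_field = \<lparr>carrier = UNIV, mult = (*), one = 1, zero = 0, add = (+),
     smult = (\<lambda>p c. Poly_Mapping.lookup p 0 * c), grade = (\<lambda>j. if j = 0 then UNIV else {0})\<rparr>"

text \<open>
  Quotient of a module by a submodule, built on the additive cosets of \<^term>\<open>M Quot H\<close>.
  In the scalar multiplication all members of the union coincide.
\<close>

definition quot_module :: "('r, 'm, 'z) module_scheme \<Rightarrow> 'm set \<Rightarrow> ('r, 'm set) module" where
  "quot_module M H = ring.extend (M Quot H)
     (module.fields (\<lambda>r X. \<Union>x\<in>X. H +>\<^bsub>M\<^esub> (r \<odot>\<^bsub>M\<^esub> x)))"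

definition graded_quot :: "('r, 'm) graded_module \<Rightarrow> 'm set \<Rightarrow> ('r, 'm set) graded_module" where
  "graded_quot M H = module.extend (quot_module M H)
     (graded_module.fields (\<lambda>j. (\<lambda>x. H +>\<^bsub>M\<^esub> x) ` grade M j))"

definition edge_ideal :: "'v set \<Rightarrow> 'v set set \<Rightarrow> ('v, 'k::field) mpoly set" where
  "edge_ideal V E = Idl\<^bsub>poly_ring V\<^esub> {mvar x * mvar y | x y. {x, y} \<in> E}"

definition edge_ring ::
  "'v set \<Rightarrow> 'v set set \<Rightarrow> (('v, 'k::field) mpoly, ('v, 'k) mpoly set) graded_module" where
  "edge_ring V E = graded_quot (poly_ring V) (edge_ideal V E)"


section \<open>Graded free resolutions and Tor\<close>

text \<open>
  Data of an augmented complex \<open>\<dots> \<rightarrow> F\<^sub>2 \<rightarrow> F\<^sub>1 \<rightarrow> F\<^sub>0 \<rightarrow> M\<close> of graded free modules of finite rank: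
  \<open>F\<^sub>i\<close> has a basis indexed by the numbers \<open>b < rank_at i\<close>, the \<open>b\<close>-th basis element having degree
  \<open>shift i b\<close>; \<open>diff_mat i c b\<close> is the coefficient at the \<open>c\<close>-th basis element of \<open>F\<^sub>i\<close> of the image
  of the \<open>b\<close>-th basis element of \<open>F\<^bsub>i+1\<^esub>\<close>; \<open>aug_gen b\<close> is the image in \<open>M\<close> of the \<open>b\<close>-th basis
  element of \<open>F\<^sub>0\<close>.
\<close>

record ('r, 'm) free_complex =
  rank_at :: "nat \<Rightarrow> nat"
  shift :: "nat \<Rightarrow> nat \<Rightarrow> int"
  diff_mat :: "nat \<Rightarrow> nat \<Rightarrow> nat \<Rightarrow> 'r"
  aug_gen :: "nat \<Rightarrow> 'm"

text \<open>
  The complex \<open>F \<otimes>\<^sub>S N\<close>. As \<open>F\<^sub>i\<close> is free, \<open>F\<^sub>i \<otimes>\<^sub>S N\<close> is the direct sum of copies of \<open>N\<close> indexed by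
  the basis of \<open>F\<^sub>i\<close>, and its component of degree \<open>j\<close> is the direct sum of the components of \<open>N\<close>
  of degree \<open>j - shift i b\<close>. Taking \<open>N = S\<close> gives \<open>F\<close> itself. Elements are functions that are
  \<open>undefined\<close> outside the index set; \<open>tensor_diff F N i\<close> maps \<open>F\<^bsub>i+1\<^esub> \<otimes> N\<close> to \<open>F\<^sub>i \<otimes> N\<close>.
\<close>

definition tensor_carrier ::
  "('r, 'm) free_complex \<Rightarrow> ('r, 'n) graded_module \<Rightarrow> nat \<Rightarrow> (nat \<Rightarrow> 'n) set" where
  "tensor_carrier F N i = (\<Pi>\<^sub>E b\<in>{..<rank_at F i}. carrier N)"

definition tensor_comp ::
  "('r, 'm) free_complex \<Rightarrow> ('r, 'n) graded_module \<Rightarrow> nat \<Rightarrow> int \<Rightarrow> (nat \<Rightarrow> 'n) set" where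
  "tensor_comp F N i j = (\<Pi>\<^sub>E b\<in>{..<rank_at F i}. grade N (j - shift F i b))"

definition tensor_zero ::
  "('r, 'm) free_complex \<Rightarrow> ('r, 'n) graded_module \<Rightarrow> nat \<Rightarrow> nat \<Rightarrow> 'n" where
  "tensor_zero F N i = (\<lambda>b\<in>{..<rank_at F i}. \<zero>\<^bsub>N\<^esub>)"

definition tensor_diff ::
  "('r, 'm) free_complex \<Rightarrow> ('r, 'n) graded_module \<Rightarrow> nat \<Rightarrow> (nat \<Rightarrow> 'n) \<Rightarrow> nat \<Rightarrow> 'n" where
  "tensor_diff F N i x =
     (\<lambda>c\<in>{..<rank_at F i}. \<Oplus>\<^bsub>N\<^esub>b\<in>{..<rank_at F (Suc i)}. diff_mat F i c b \<odot>\<^bsub>N\<^esub> x b)"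

definition augmentation ::
  "('r, 'm) free_complex \<Rightarrow> ('r, 'm) graded_module \<Rightarrow> (nat \<Rightarrow> 'r) \<Rightarrow> 'm" where
  "augmentation F M x = (\<Oplus>\<^bsub>M\<^esub>b\<in>{..<rank_at F 0}. x b \<odot>\<^bsub>M\<^esub> aug_gen F b)"

text \<open>
  Graded free resolutions (not necessarily minimal or of finite length) of a finitely generated
  graded \<open>S\<close>-module \<open>M\<close>: all maps are homogeneous of degree 0 and the augmented complex is exact.
\<close>

definition graded_free_resolution ::
  "('r, 'r) graded_module \<Rightarrow> ('r, 'm) graded_module \<Rightarrow> ('r, 'm) free_complex \<Rightarrow> bool" where
  "graded_free_resolution S M F \<longleftrightarrow>
     (\<forall>i. \<forall>c<rank_at F i. \<forall>b<rank_at F (Suc i).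
        diff_mat F i c b \<in> grade S (shift F (Suc i) b - shift F i c)) \<and>
     (\<forall>b<rank_at F 0. aug_gen F b \<in> grade M (shift F 0 b)) \<and>
     (\<forall>i. {x \<in> tensor_carrier F S (Suc i). tensor_diff F S i x = tensor_zero F S i} =
        tensor_diff F S (Suc i) ` tensor_carrier F S (Suc (Suc i))) \<and>
     {x \<in> tensor_carrier F S 0. augmentation F M x = \<zero>\<^bsub>M\<^esub>} =
        tensor_diff F S 0 ` tensor_carrier F S (Suc 0) \<and>
     augmentation F M ` tensor_carrier F S 0 = carrier M"

text \<open>
  Cycles of \<open>F \<otimes>\<^sub>S N\<close> in homological degree \<open>i\<close> and internal degree \<open>j\<close> as a \<open>K\<close>-vector space,
  and the subspace of boundaries.
\<close>

definition tor_cycles ::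
  "(('v, 'k::field) mpoly, 'm) free_complex \<Rightarrow> (('v, 'k) mpoly, 'n) graded_module \<Rightarrow> nat \<Rightarrow> int \<Rightarrow>
   ('k, nat \<Rightarrow> 'n) module" where
  "tor_cycles F N i j =
     \<lparr>carrier = {x \<in> tensor_comp F N i j.
        case i of 0 \<Rightarrow> True | Suc k \<Rightarrow> tensor_diff F N k x = tensor_zero F N k},
      mult = undefined, one = undefined, zero = tensor_zero F N i,
      add = (\<lambda>x y. \<lambda>b\<in>{..<rank_at F i}. x b \<oplus>\<^bsub>N\<^esub> y b),
      smult = (\<lambda>c x. \<lambda>b\<in>{..<rank_at F i}. mconst c \<odot>\<^bsub>N\<^esub> x b)\<rparr>"

definition tor_boundaries ::
  "('r, 'm) free_complex \<Rightarrow> ('r, 'n) graded_module \<Rightarrow> nat \<Rightarrow> int \<Rightarrow> (nat \<Rightarrow> 'n) set" where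
  "tor_boundaries F N i j = tensor_diff F N i ` tensor_comp F N (Suc i) j"

text \<open>
  The component of degree \<open>j\<close> of \<open>Tor\<^sub>i\<^sup>S(M, N)\<close>, for \<open>M\<close> finitely generated, as a \<open>K\<close>-vector
  space. As usual a resolution of \<open>M\<close> is chosen; up to isomorphism the result does not depend on it.
\<close>

definition Tor ::
  "'v set \<Rightarrow> (('v, 'k::field) mpoly, 'm) graded_module \<Rightarrow> (('v, 'k) mpoly, 'n) graded_module \<Rightarrow>
   nat \<Rightarrow> int \<Rightarrow> ('k, (nat \<Rightarrow> 'n) set) module" where
  "Tor V M N i j =
     (let F = (SOME F. graded_free_resolution (poly_ring V) M F)
      in quot_module (tor_cycles F N i j) (tor_boundaries F N i j))"

definition betti ::
  "'v set \<Rightarrow> (('v, 'k::field) mpoly, 'n) graded_module \<Rightarrow> nat \<Rightarrow> int \<Rightarrow> nat" where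
  "betti V N i j = vectorspace.dim (class_ring :: 'k ring) (Tor V residue_field N i j)"

definition regularity :: "'v set \<Rightarrow> (('v, 'k::field) mpoly, 'n) graded_module \<Rightarrow> int" where
  "regularity V N = Max {j - int i | i j. betti V N i j \<noteq> 0}"

end

theory Submission
  imports Defs "HOL-Library.Function_Algebras"
begin

text \<open>
  The graph consists of \<open>a\<close> disjoint five-cycles, a clique on \<open>2 b + 2\<close> further vertices, and an
  apex joined to everything. A five-cycle has induced matching number 1 and regularity 2, the clique
  has regularity 1 and minimal maximal matchings of size \<open>b + 1\<close>, and the apex only makes the graph
  connected, so that \<open>ind-match = a + 1\<close>, \<open>reg = 2 a + 1\<close> and \<open>min-match = 2 a + b + 1\<close>.

  The regularity is computed from an arbitrary resolution \<open>F\<close> of \<open>K\<close>. A short exact sequence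
  \<open>0 \<rightarrow> S/(I : m)(-deg m) \<rightarrow> S/I \<rightarrow> S/(I + (m)) \<rightarrow> 0\<close> stays exact after tensoring with \<open>F\<close>, and the
  long exact homology sequence lets one build the graph vertex by vertex. The regularity alone is
  ambiguous when both outer terms have the same one (as happens for the five-cycle), so the largest
  homological degree in which it is attained is tracked as well. The Koszul complex is only needed to
  know that a resolution exists.
\<close>

section \<open>Monomial ideals described by supports\<close>

text \<open>\<open>Tor\<close> is defined by resolving \<open>K\<close> rather than the quotient
  ring. One complex \<open>F\<close> therefore serves every ideal that occurs, and two ideals can be
  compared without relating two resolutions. Disjoint unions need no Kuenneth formula: each building
  step adds vertices to an arbitrary ideal that ignores those vertices. The size
  \<open>2*b + 2\<close> of the clique is dictated by the apex. A maximal matching of minimum size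
  should cover the apex at no extra cost, since otherwise an uncovered vertex could still be joined
  to it. All clique vertices but one, together with the apex, are \<open>2*b + 2\<close> vertices
  and fit exactly into \<open>b + 1\<close> edges. A five-cycle always needs two edges because a
  vertex cover of it has three elements; so it adds 2 to both the regularity and the matching size,
  but only 1 to the induced matching number. The apex does not raise the regularity because its
  colon ideal is generated by all other variables, so that this outer term has regularity 0.\<close>

definition hcomp :: "'v set \<Rightarrow> int \<Rightarrow> ('v, 'k::field) mpoly set" where
  "hcomp V j = {p \<in> polys_in V. \<forall>m\<in>Poly_Mapping.keys p. int (mon_degree m) = j}"

text \<open>For monotone \<open>P\<close> this is the squarefree monomial ideal whose
  Stanley-Reisner nonfaces are the sets satisfying \<open>P\<close>. Sums with, and colons by,
  squarefree monomials become Boolean operations on predicates.\<close>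

definition mideal :: "'v set \<Rightarrow> ('v set \<Rightarrow> bool) \<Rightarrow> ('v, 'k::field) mpoly set" where
  "mideal V P = {p \<in> polys_in V. \<forall>m\<in>Poly_Mapping.keys p. P (Poly_Mapping.keys m)}"

definition pfilter :: "('a \<Rightarrow> bool) \<Rightarrow> ('a \<Rightarrow>\<^sub>0 'b::comm_monoid_add) \<Rightarrow> 'a \<Rightarrow>\<^sub>0 'b" where
  "pfilter Q p = (\<Sum>m | m \<in> Poly_Mapping.keys p \<and> Q m.
     Poly_Mapping.single m (Poly_Mapping.lookup p m))"

definition ones :: "'v set \<Rightarrow> 'v \<Rightarrow>\<^sub>0 nat" where
  "ones Z = (\<Sum>z\<in>Z. Poly_Mapping.single z 1)"

definition sqf :: "'v set \<Rightarrow> ('v, 'k::field) mpoly" where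
  "sqf Z = Poly_Mapping.single (ones Z) 1"

lemma lookup_pfilter:
  "Poly_Mapping.lookup (pfilter Q p) m = (if Q m then Poly_Mapping.lookup p m else 0)"
proof -
  have "Poly_Mapping.lookup (pfilter Q p) m =
    (\<Sum>i | i \<in> Poly_Mapping.keys p \<and> Q i. if i = m then Poly_Mapping.lookup p m else 0)"
    unfolding pfilter_def lookup_sum
    by (rule sum.cong) (auto simp: lookup_single when_def)
  also have "\<dots> = (if Q m then Poly_Mapping.lookup p m else 0)"
    by (subst sum.delta) (auto simp: in_keys_iff)
  finally show ?thesis .
qed

lemma keys_pfilter: "Poly_Mapping.keys (pfilter Q p) = {m \<in> Poly_Mapping.keys p. Q m}"
  by (auto simp: in_keys_iff lookup_pfilter split: if_splits)

lemma pfilter_add: "pfilter Q (p + q) = pfilter Q p + pfilter Q q"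
  by (rule poly_mapping_eqI) (simp add: lookup_pfilter lookup_add)

lemma pfilter_0 [simp]: "pfilter Q 0 = 0"
  by (rule poly_mapping_eqI) (simp add: lookup_pfilter)

lemma pfilter_sum: "pfilter Q (sum f A) = (\<Sum>x\<in>A. pfilter Q (f x))"
  by (induction A rule: infinite_finite_induct) (auto simp: pfilter_add)

lemma pfilter_id: "(\<And>m. m \<in> Poly_Mapping.keys p \<Longrightarrow> Q m) \<Longrightarrow> pfilter Q p = p"
  by (rule poly_mapping_eqI) (auto simp: lookup_pfilter in_keys_iff)

lemma pfilter_none: "(\<And>m. m \<in> Poly_Mapping.keys p \<Longrightarrow> \<not> Q m) \<Longrightarrow> pfilter Q p = 0"
  by (rule poly_mapping_eqI) (auto simp: lookup_pfilter in_keys_iff)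

lemma pfilter_add_not: "pfilter Q p + pfilter (\<lambda>m. \<not> Q m) p = p"
  by (rule poly_mapping_eqI) (auto simp: lookup_pfilter lookup_add)

lemma poly_mapping_expand:
  "p = (\<Sum>m\<in>Poly_Mapping.keys p. Poly_Mapping.single m (Poly_Mapping.lookup p m))"
  using pfilter_id[of p "\<lambda>_. True"] by (simp add: pfilter_def)

lemma keys_nat_add:
  "Poly_Mapping.keys ((s :: 'a \<Rightarrow>\<^sub>0 nat) + t) = Poly_Mapping.keys s \<union> Poly_Mapping.keys t"
  by (auto simp: in_keys_iff lookup_add)

lemma lookup_ones:
  "finite Z \<Longrightarrow> Poly_Mapping.lookup (ones Z) x = (if x \<in> Z then 1 else 0)"
  by (simp add: ones_def lookup_sum lookup_single when_def)

lemma keys_ones: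
  "finite Z \<Longrightarrow> Poly_Mapping.keys (ones Z) = Z"
  by (auto simp: in_keys_iff lookup_ones split: if_splits)

lemma mon_degree_superset:
  "finite A \<Longrightarrow> Poly_Mapping.keys m \<subseteq> A \<Longrightarrow> mon_degree m = (\<Sum>x\<in>A. Poly_Mapping.lookup m x)"
  unfolding mon_degree_def by (rule sum.mono_neutral_left) (auto simp: in_keys_iff)

lemma mon_degree_add: "mon_degree (s + t) = mon_degree s + mon_degree t"
proof -
  let ?A = "Poly_Mapping.keys s \<union> Poly_Mapping.keys t"
  have "mon_degree (s + t) = (\<Sum>x\<in>?A. Poly_Mapping.lookup (s + t) x)"
    by (rule mon_degree_superset) (auto simp: keys_nat_add)
  also have "\<dots> = mon_degree s + mon_degree t"
    by (simp add: lookup_add sum.distrib mon_degree_superset[of ?A])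
  finally show ?thesis .
qed

lemma mon_degree_0 [simp]: "mon_degree 0 = 0"
  by (simp add: mon_degree_def)

lemma mon_degree_ones:
  "finite Z \<Longrightarrow> mon_degree (ones Z) = card Z"
  unfolding mon_degree_def by (simp add: keys_ones lookup_ones)

lemma polys_in_0 [simp]: "0 \<in> polys_in V" and polys_in_1 [simp]: "1 \<in> polys_in V"
  by (auto simp: polys_in_def)

lemma polys_in_add: "p \<in> polys_in V \<Longrightarrow> q \<in> polys_in V \<Longrightarrow> p + q \<in> polys_in V"
  using keys_add[of p q] by (force simp: polys_in_def)

lemma polys_in_mult: "p \<in> polys_in V \<Longrightarrow> q \<in> polys_in V \<Longrightarrow> p * q \<in> polys_in V"
  using keys_mult[of p q] by (fastforce simp: polys_in_def keys_nat_add)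

lemma keys_uminus_poly: "Poly_Mapping.keys (- p :: 'a \<Rightarrow>\<^sub>0 'b::ab_group_add) = Poly_Mapping.keys p"
  by (auto simp: in_keys_iff)

lemma polys_in_uminus: "p \<in> polys_in V \<Longrightarrow> - p \<in> polys_in V"
  by (simp add: polys_in_def keys_uminus_poly)

lemma polys_in_diff: "p \<in> polys_in V \<Longrightarrow> q \<in> polys_in V \<Longrightarrow> p - q \<in> polys_in V"
  using polys_in_add[of p V "- q"] by (simp add: polys_in_uminus)

lemma polys_in_sum: "(\<And>x. x \<in> A \<Longrightarrow> f x \<in> polys_in V) \<Longrightarrow> sum f A \<in> polys_in V"
  by (induction A rule: infinite_finite_induct) (auto simp: polys_in_add)

lemma hcomp_subset: "p \<in> hcomp V j \<Longrightarrow> p \<in> polys_in V"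
  by (simp add: hcomp_def)

lemma hcomp_0 [simp]: "0 \<in> hcomp V j"
  by (simp add: hcomp_def)

lemma hcomp_add: "p \<in> hcomp V j \<Longrightarrow> q \<in> hcomp V j \<Longrightarrow> p + q \<in> hcomp V j"
  using keys_add[of p q] by (fastforce simp: hcomp_def polys_in_add)

lemma hcomp_uminus: "p \<in> hcomp V j \<Longrightarrow> - p \<in> hcomp V j"
  by (simp add: hcomp_def polys_in_uminus keys_uminus_poly)

lemma hcomp_diff: "p \<in> hcomp V j \<Longrightarrow> q \<in> hcomp V j \<Longrightarrow> p - q \<in> hcomp V j"
  using hcomp_add[of p V j "- q"] by (simp add: hcomp_uminus)

lemma hcomp_mult: "p \<in> hcomp V i \<Longrightarrow> q \<in> hcomp V j \<Longrightarrow> p * q \<in> hcomp V (i + j)"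
  using keys_mult[of p q] by (fastforce simp: hcomp_def polys_in_mult mon_degree_add)

lemma hcomp_sum: "(\<And>x. x \<in> A \<Longrightarrow> f x \<in> hcomp V j) \<Longrightarrow> sum f A \<in> hcomp V j"
  by (induction A rule: infinite_finite_induct) (auto simp: hcomp_add)

lemma mideal_subset: "p \<in> mideal V P \<Longrightarrow> p \<in> polys_in V"
  by (simp add: mideal_def)

lemma mideal_0 [simp]: "0 \<in> mideal V P"
  by (simp add: mideal_def)

lemma mideal_add: "p \<in> mideal V P \<Longrightarrow> q \<in> mideal V P \<Longrightarrow> p + q \<in> mideal V P"
  using keys_add[of p q] by (fastforce simp: mideal_def polys_in_add)

lemma mideal_uminus: "p \<in> mideal V P \<Longrightarrow> - p \<in> mideal V P"
  by (simp add: mideal_def polys_in_uminus keys_uminus_poly)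

lemma mideal_diff: "p \<in> mideal V P \<Longrightarrow> q \<in> mideal V P \<Longrightarrow> p - q \<in> mideal V P"
  using mideal_add[of p V P "- q"] by (simp add: mideal_uminus)

lemma mideal_mult:
  assumes "mono P" "p \<in> polys_in V" "q \<in> mideal V P"
  shows "p * q \<in> mideal V P"
proof -
  have "P (Poly_Mapping.keys m)" if m: "m \<in> Poly_Mapping.keys (p * q)" for m
  proof -
    obtain s t where "m = s + t" and t: "t \<in> Poly_Mapping.keys q"
      using keys_mult[of p q] m by auto
    then have "Poly_Mapping.keys t \<subseteq> Poly_Mapping.keys m" by (simp add: keys_nat_add)
    moreover have "P (Poly_Mapping.keys t)" using t assms(3) by (simp add: mideal_def)
    ultimately show ?thesis using assms(1) by (auto dest: monoD)
  qed
  then show ?thesis using assms by (simp add: mideal_def polys_in_mult)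
qed

lemma mideal_sum: "(\<And>x. x \<in> A \<Longrightarrow> f x \<in> mideal V P) \<Longrightarrow> sum f A \<in> mideal V P"
  by (induction A rule: infinite_finite_induct) (auto simp: mideal_add)

lemma mideal_mono: "(\<And>A. P A \<Longrightarrow> P' A) \<Longrightarrow> p \<in> mideal V P \<Longrightarrow> p \<in> mideal V P'"
  by (simp add: mideal_def)

lemma lookup_single_times:
  fixes p :: "('v \<Rightarrow>\<^sub>0 nat) \<Rightarrow>\<^sub>0 'k::comm_ring_1"
  shows "Poly_Mapping.lookup (Poly_Mapping.single t 1 * p) (t + s) = Poly_Mapping.lookup p s"
proof -
  have "Poly_Mapping.single t 1 * p =
      (\<Sum>m\<in>Poly_Mapping.keys p. Poly_Mapping.single (t + m) (Poly_Mapping.lookup p m))"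
    by (subst (1) poly_mapping_expand[of p]) (simp add: sum_distrib_left mult_single)
  then show ?thesis
    by (auto simp: lookup_sum lookup_single when_def in_keys_iff)
qed

lemma keys_single_times:
  fixes p :: "('v \<Rightarrow>\<^sub>0 nat) \<Rightarrow>\<^sub>0 'k::comm_ring_1"
  shows "Poly_Mapping.keys (Poly_Mapping.single t 1 * p) = (+) t ` Poly_Mapping.keys p"
proof
  show "Poly_Mapping.keys (Poly_Mapping.single t 1 * p) \<subseteq> (+) t ` Poly_Mapping.keys p"
    using keys_mult[of "Poly_Mapping.single t 1" p] by auto
  show "(+) t ` Poly_Mapping.keys p \<subseteq> Poly_Mapping.keys (Poly_Mapping.single t 1 * p)"
    by (auto simp: in_keys_iff lookup_single_times)
qed

lemma sqf_mem: "finite Z \<Longrightarrow> Z \<subseteq> V \<Longrightarrow> sqf Z \<in> hcomp V (int (card Z))"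
  by (auto simp: sqf_def hcomp_def polys_in_def keys_ones mon_degree_ones)

text \<open>Multiplication by the monomial of \<open>Z\<close> enlarges every support by exactly
  \<open>Z\<close>, so the predicate on the right describes the colon ideal.\<close>

lemma sqf_times_mem_iff:
  assumes "finite Z" "Z \<subseteq> V" "p \<in> polys_in V"
  shows "sqf Z * p \<in> mideal V P \<longleftrightarrow> p \<in> mideal V (\<lambda>A. P (A \<union> Z))"
  using assms polys_in_mult[OF hcomp_subset[OF sqf_mem[OF assms(1,2)]] assms(3)]
  by (simp add: mideal_def sqf_def keys_single_times keys_nat_add keys_ones Un_commute)

text \<open>The monomials satisfying \<open>P\<close> form \<open>q\<close>; every other monomial
  has \<open>Z\<close> in its support and is divisible by \<open>sqf Z\<close>. Since the split is
  done monomial by monomial, homogeneity passes to both parts.\<close>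

lemma sqf_division:
  fixes p :: "('v, 'k::field) mpoly"
  assumes "finite Z" "p \<in> mideal V (\<lambda>A. P A \<or> Z \<subseteq> A)"
  obtains q s where "p = q + sqf Z * s" "q \<in> mideal V P" "s \<in> polys_in V"
    "\<And>g. p \<in> hcomp V g \<Longrightarrow> q \<in> hcomp V g \<and> s \<in> hcomp V (g - int (card Z))"
proof -
  let ?Q = "\<lambda>m. P (Poly_Mapping.keys m)"
  let ?q = "pfilter ?Q p" and ?r = "pfilter (\<lambda>m. \<not> ?Q m) p"
  let ?t = "ones Z"
  define s :: "('v, 'k) mpoly" where "s = (\<Sum>m\<in>Poly_Mapping.keys ?r.
    Poly_Mapping.single (m - ?t) (Poly_Mapping.lookup ?r m))"
  \<comment> \<open>Exponents on \<open>Z\<close> are at least 1, so the truncated subtraction is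
    exact.\<close>
  have div: "?t + (m - ?t) = m" if "m \<in> Poly_Mapping.keys ?r" for m
  proof (rule poly_mapping_eqI)
    fix x
    have "Z \<subseteq> Poly_Mapping.keys m" using that assms(2) by (auto simp: keys_pfilter mideal_def)
    then have "x \<in> Z \<Longrightarrow> Poly_Mapping.lookup m x \<ge> 1" by (auto simp: in_keys_iff Suc_le_eq)
    then show "Poly_Mapping.lookup (?t + (m - ?t)) x = Poly_Mapping.lookup m x"
      using assms(1) by (simp add: lookup_add lookup_minus lookup_ones)
  qed
  have vars: "Poly_Mapping.keys (m - ?t) \<subseteq> V" if "m \<in> Poly_Mapping.keys ?r" for m
  proof -
    have "Poly_Mapping.keys (m - ?t) \<subseteq> Poly_Mapping.keys m"
      using div[OF that] keys_nat_add[of ?t "m - ?t"] by auto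
    also have "\<dots> \<subseteq> V" using that assms(2) by (auto simp: keys_pfilter mideal_def polys_in_def)
    finally show ?thesis .
  qed
  have "sqf Z * s = ?r"
    unfolding s_def sqf_def
    by (subst (3) poly_mapping_expand[of ?r]) (auto simp: sum_distrib_left mult_single div intro!: sum.cong)
  then have "p = ?q + sqf Z * s" by (simp add: pfilter_add_not)
  moreover have "?q \<in> mideal V P"
    using assms(2) by (auto simp: mideal_def polys_in_def keys_pfilter)
  moreover have "s \<in> polys_in V"
    unfolding s_def by (intro polys_in_sum) (use vars in \<open>auto simp: polys_in_def\<close>)
  moreover have "?q \<in> hcomp V g \<and> s \<in> hcomp V (g - int (card Z))" if g: "p \<in> hcomp V g" for g
  proof
    show "?q \<in> hcomp V g" using g by (auto simp: hcomp_def polys_in_def keys_pfilter)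
    show "s \<in> hcomp V (g - int (card Z))" unfolding s_def
    proof (rule hcomp_sum)
      fix m assume m: "m \<in> Poly_Mapping.keys ?r"
      have "int (mon_degree m) = g" using m g by (auto simp: keys_pfilter hcomp_def)
      moreover have "mon_degree m = card Z + mon_degree (m - ?t)"
        using div[OF m] mon_degree_add[of ?t "m - ?t"] assms(1) by (simp add: mon_degree_ones)
      ultimately show "Poly_Mapping.single (m - ?t) (Poly_Mapping.lookup ?r m) \<in> hcomp V (g - int (card Z))"
        using vars[OF m] by (auto simp: hcomp_def polys_in_def)
    qed
  qed
  ultimately show thesis using that by blast
qed

section \<open>Homogeneous components of a polynomial\<close>

definition hpart :: "int \<Rightarrow> ('v, 'k::field) mpoly \<Rightarrow> ('v, 'k) mpoly" where
  "hpart j = pfilter (\<lambda>m. int (mon_degree m) = j)"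

lemma hpart_mem: "p \<in> polys_in V \<Longrightarrow> hpart j p \<in> hcomp V j"
  by (auto simp: hpart_def hcomp_def polys_in_def keys_pfilter)

lemma hpart_id: "p \<in> hcomp V j \<Longrightarrow> hpart j p = p"
  unfolding hpart_def by (rule pfilter_id) (auto simp: hcomp_def)

lemma hpart_mult:
  assumes "f \<in> hcomp V g" "p \<in> polys_in V"
  shows "hpart j (f * p) = f * hpart (j - g) p"
proof -
  let ?r = "pfilter (\<lambda>m. \<not> int (mon_degree m) = j - g) p"
  have "hpart (j - g) p + ?r = p"
    unfolding hpart_def by (rule pfilter_add_not)
  then have "f * p = f * hpart (j - g) p + f * ?r" by (metis distrib_left)
  then have "hpart j (f * p) = hpart j (f * hpart (j - g) p) + hpart j (f * ?r)"
    by (simp add: hpart_def pfilter_add)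
  also have "hpart j (f * hpart (j - g) p) = f * hpart (j - g) p"
    using hcomp_mult[OF assms(1) hpart_mem[OF assms(2), of "j - g"]] by (intro hpart_id[of _ V]) simp
  also have "hpart j (f * ?r) = 0" unfolding hpart_def
  proof (rule pfilter_none)
    fix m assume "m \<in> Poly_Mapping.keys (f * ?r)"
    then obtain s t where "m = s + t" "s \<in> Poly_Mapping.keys f" "t \<in> Poly_Mapping.keys ?r"
      using keys_mult[of f ?r] by auto
    then show "int (mon_degree m) \<noteq> j"
      using assms(1) by (auto simp: hcomp_def keys_pfilter mon_degree_add)
  qed
  finally show ?thesis by simp
qed

section \<open>Vanishing of Tor along short exact sequences\<close>

locale free_cplx =
  fixes V :: "'v set" and rk :: "nat \<Rightarrow> nat" and sh :: "nat \<Rightarrow> nat \<Rightarrow> int"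
    and D :: "nat \<Rightarrow> nat \<Rightarrow> nat \<Rightarrow> ('v, 'k::field) mpoly"
begin

definition d :: "nat \<Rightarrow> (nat \<Rightarrow> ('v, 'k) mpoly) \<Rightarrow> nat \<Rightarrow> ('v, 'k) mpoly" where
  "d i x c = (\<Sum>b<rk (Suc i). D i c b * x b)"

text \<open>Chains are total functions of which only the values below \<open>rk i\<close> count.
  Extensional functions and cosets enter only when the results are compared with the definition of
  \<open>Tor\<close>.\<close>

definition chain :: "nat \<Rightarrow> (nat \<Rightarrow> ('v, 'k) mpoly) \<Rightarrow> bool" where
  "chain i x \<longleftrightarrow> (\<forall>b<rk i. x b \<in> polys_in V)"

definition hchain :: "nat \<Rightarrow> int \<Rightarrow> (nat \<Rightarrow> ('v, 'k) mpoly) \<Rightarrow> bool" where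
  "hchain i j x \<longleftrightarrow> (\<forall>b<rk i. x b \<in> hcomp V (j - sh i b))"

definition ichain :: "('v set \<Rightarrow> bool) \<Rightarrow> nat \<Rightarrow> (nat \<Rightarrow> ('v, 'k) mpoly) \<Rightarrow> bool" where
  "ichain P i x \<longleftrightarrow> (\<forall>b<rk i. x b \<in> mideal V P)"

definition cyc :: "('v set \<Rightarrow> bool) \<Rightarrow> nat \<Rightarrow> int \<Rightarrow> (nat \<Rightarrow> ('v, 'k) mpoly) \<Rightarrow> bool" where
  "cyc P i j x \<longleftrightarrow> hchain i j x \<and> (case i of 0 \<Rightarrow> True | Suc k \<Rightarrow> ichain P k (d k x))"

definition bdry :: "('v set \<Rightarrow> bool) \<Rightarrow> nat \<Rightarrow> int \<Rightarrow> (nat \<Rightarrow> ('v, 'k) mpoly) \<Rightarrow> bool" where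
  "bdry P i j x \<longleftrightarrow> (\<exists>y. hchain (Suc i) j y \<and> ichain P i (\<lambda>b. x b - d i y b))"

text \<open>This says that \<open>H\<^sub>i(F \<otimes> S/I)\<^sub>j = 0\<close> for the monomial ideal \<open>I\<close> with support predicate \<open>P\<close>,
  expressed on lifts to \<open>F\<close>.\<close>

definition van :: "('v set \<Rightarrow> bool) \<Rightarrow> nat \<Rightarrow> int \<Rightarrow> bool" where
  "van P i j \<longleftrightarrow> (\<forall>x. cyc P i j x \<longrightarrow> bdry P i j x)"

lemma d_add: "d i (\<lambda>b. x b + y b) c = d i x c + d i y c"
  by (simp add: d_def distrib_left sum.distrib)

lemma d_diff: "d i (\<lambda>b. x b - y b) c = d i x c - d i y c"
  by (simp add: d_def right_diff_distrib sum_subtractf)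

lemma d_mult: "d i (\<lambda>b. m * y b) c = m * d i y c"
  by (simp add: d_def sum_distrib_left mult_ac)

lemma d_uminus: "d i (\<lambda>b. - y b) c = - d i y c"
  by (simp add: d_def sum_negf)

lemma d_cong: "(\<And>b. b < rk (Suc i) \<Longrightarrow> x b = y b) \<Longrightarrow> d i x c = d i y c"
  by (simp add: d_def)

lemma hchain_chain: "hchain i j x \<Longrightarrow> chain i x"
  by (auto simp: hchain_def chain_def dest: hcomp_subset)

lemma hchain_add: "hchain i j x \<Longrightarrow> hchain i j y \<Longrightarrow> hchain i j (\<lambda>b. x b + y b)"
  by (simp add: hchain_def hcomp_add)

lemma hchain_diff: "hchain i j x \<Longrightarrow> hchain i j y \<Longrightarrow> hchain i j (\<lambda>b. x b - y b)"
  by (simp add: hchain_def hcomp_diff)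

lemma ichain_add: "ichain P i x \<Longrightarrow> ichain P i y \<Longrightarrow> ichain P i (\<lambda>b. x b + y b)"
  by (simp add: ichain_def mideal_add)

lemma ichain_diff: "ichain P i x \<Longrightarrow> ichain P i y \<Longrightarrow> ichain P i (\<lambda>b. x b - y b)"
  by (simp add: ichain_def mideal_diff)

lemma ichain_uminus: "ichain P i x \<Longrightarrow> ichain P i (\<lambda>b. - x b)"
  by (simp add: ichain_def mideal_uminus)

lemma ichain_mono: "(\<And>A. P A \<Longrightarrow> P' A) \<Longrightarrow> ichain P i x \<Longrightarrow> ichain P' i x"
  by (auto simp: ichain_def intro: mideal_mono)

lemma ichain_cong: "ichain P i x \<Longrightarrow> (\<And>b. b < rk i \<Longrightarrow> x b = y b) \<Longrightarrow> ichain P i y"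
  by (simp add: ichain_def)

end

text \<open>The elementwise form of a graded free resolution of \<open>K\<close>;
  \<open>aug_homog\<close> records that \<open>K\<close> lives in degree 0. Exactness is stated for
  inhomogeneous chains, and \<open>homog_preimage\<close> recovers the graded version.\<close>

locale field_resolution = free_cplx V rk sh D
  for V :: "'v set" and rk sh and D :: "nat \<Rightarrow> nat \<Rightarrow> nat \<Rightarrow> ('v, 'k::field) mpoly" +
  fixes aug :: "nat \<Rightarrow> 'k"
  assumes homog: "c < rk i \<Longrightarrow> b < rk (Suc i) \<Longrightarrow> D i c b \<in> hcomp V (sh (Suc i) b - sh i c)"
    and dd: "chain (Suc (Suc i)) x \<Longrightarrow> c < rk i \<Longrightarrow> d i (d (Suc i) x) c = 0"
    and exact: "chain (Suc i) x \<Longrightarrow> (\<And>c. c < rk i \<Longrightarrow> d i x c = 0) \<Longrightarrow>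
      \<exists>y. chain (Suc (Suc i)) y \<and> (\<forall>b<rk (Suc i). x b = d (Suc i) y b)"
    and aug_homog: "b < rk 0 \<Longrightarrow> aug b \<noteq> 0 \<Longrightarrow> sh 0 b = 0"
    and aug_exact: "chain 0 x \<Longrightarrow> (\<Sum>b<rk 0. Poly_Mapping.lookup (x b) 0 * aug b) = 0 \<longleftrightarrow>
      (\<exists>y. chain (Suc 0) y \<and> (\<forall>b<rk 0. x b = d 0 y b))"
    and aug_surj: "\<exists>x. chain 0 x \<and> (\<Sum>b<rk 0. Poly_Mapping.lookup (x b) 0 * aug b) = 1"
begin

lemma D_polys: "c < rk i \<Longrightarrow> b < rk (Suc i) \<Longrightarrow> D i c b \<in> polys_in V"
  using homog hcomp_subset by blast

lemma d_hchain:
  assumes "hchain (Suc i) j x" shows "hchain i j (d i x)"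
  unfolding hchain_def d_def
proof (intro allI impI hcomp_sum)
  fix c b assume "c < rk i" and "b \<in> {..<rk (Suc i)}"
  then have "D i c b * x b \<in> hcomp V ((sh (Suc i) b - sh i c) + (j - sh (Suc i) b))"
    using assms by (intro hcomp_mult homog) (auto simp: hchain_def)
  then show "D i c b * x b \<in> hcomp V (j - sh i c)" by simp
qed

lemma d_chain: "chain (Suc i) x \<Longrightarrow> chain i (d i x)"
  unfolding chain_def d_def by (auto intro!: polys_in_sum polys_in_mult D_polys)

lemma d_ichain: "mono P \<Longrightarrow> ichain P (Suc i) x \<Longrightarrow> ichain P i (d i x)"
  unfolding ichain_def d_def by (auto intro!: mideal_sum mideal_mult D_polys)

lemma d_hpart:
  assumes "chain (Suc i) x" "c < rk i"
  shows "d i (\<lambda>b. hpart (j - sh (Suc i) b) (x b)) c = hpart (j - sh i c) (d i x c)"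
proof -
  have "hpart (j - sh i c) (D i c b * x b) = D i c b * hpart (j - sh (Suc i) b) (x b)"
    if "b < rk (Suc i)" for b
    using hpart_mult[OF homog[OF assms(2) that], of "x b" "j - sh i c"] that assms(1)
    by (simp add: chain_def algebra_simps)
  then show ?thesis unfolding d_def by (simp add: hpart_def pfilter_sum)
qed

lemma hchain_hpart: "chain i x \<Longrightarrow> hchain i j (\<lambda>b. hpart (j - sh i b) (x b))"
  by (auto simp: chain_def hchain_def hpart_mem)

text \<open>The differential has degree 0, so the degree \<open>j\<close> component of any preimage
  is still a preimage.\<close>

lemma homog_preimage:
  assumes "hchain i j x" "chain (Suc i) y" "\<forall>b<rk i. x b = d i y b"
  shows "\<exists>y. hchain (Suc i) j y \<and> (\<forall>b<rk i. x b = d i y b)"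
proof (intro exI conjI allI impI)
  show "hchain (Suc i) j (\<lambda>b. hpart (j - sh (Suc i) b) (y b))"
    using assms(2) by (rule hchain_hpart)
  fix b assume b: "b < rk i"
  show "x b = d i (\<lambda>b. hpart (j - sh (Suc i) b) (y b)) b"
    using assms(1) b d_hpart[OF assms(2) b, of j] assms(3)[rule_format, OF b]
    by (metis hpart_id hchain_def)
qed

lemma bdryI:
  assumes "hchain (Suc i) j y" "ichain P i u" "\<And>b. b < rk i \<Longrightarrow> x b = d i y b + u b"
  shows "bdry P i j x"
  unfolding bdry_def using assms by (intro exI[of _ y]) (auto simp: ichain_def)

lemma bdryE:
  assumes "bdry P i j x" "hchain i j x"
  obtains y u where "hchain (Suc i) j y" "ichain P i u" "hchain i j u"
    "\<And>b. b < rk i \<Longrightarrow> x b = d i y b + u b"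
proof -
  obtain y where y: "hchain (Suc i) j y" "ichain P i (\<lambda>b. x b - d i y b)"
    using assms(1) by (auto simp: bdry_def)
  show thesis
    by (rule that[of y "\<lambda>b. x b - d i y b"]) (use y assms(2) hchain_diff d_hchain in auto)
qed

lemma vanE:
  assumes "van P i j" "cyc P i j x"
  obtains y u where "hchain (Suc i) j y" "ichain P i u" "hchain i j u"
    "\<And>b. b < rk i \<Longrightarrow> x b = d i y b + u b"
  using assms bdryE unfolding van_def cyc_def by blast

text \<open>Here \<open>S/J' \<rightarrow> S/J \<rightarrow> S/J''\<close> with \<open>J' = J : x\<^sub>Z\<close> and \<open>J'' = J + (x\<^sub>Z)\<close>, the first map being
  multiplication by the squarefree monomial \<open>x\<^sub>Z\<close>.\<close>

context
  fixes P :: "'v set \<Rightarrow> bool" and Z :: "'v set"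
  assumes P: "mono P" and Z: "finite Z" "Z \<subseteq> V"
begin

abbreviation (input) "colon \<equiv> (\<lambda>A. P (A \<union> Z))"
abbreviation (input) "plus_ideal \<equiv> (\<lambda>A. P A \<or> Z \<subseteq> A)"

lemma mono_plus: "mono (\<lambda>A. P A \<or> Z \<subseteq> A)"
  using P by (intro monoI) (auto dest: monoD)

lemma hchain_sqf: "hchain i (j - int (card Z)) s \<Longrightarrow> hchain i j (\<lambda>b. sqf Z * s b)"
proof -
  assume s: "hchain i (j - int (card Z)) s"
  have "sqf Z * s b \<in> hcomp V (int (card Z) + (j - int (card Z) - sh i b))" if "b < rk i" for b
    using s that by (intro hcomp_mult sqf_mem Z) (auto simp: hchain_def)
  then show ?thesis by (simp add: hchain_def)
qed

lemma ichain_sqf: "chain i s \<Longrightarrow> ichain P i (\<lambda>b. sqf Z * s b) \<longleftrightarrow> ichain colon i s"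
  unfolding ichain_def chain_def by (auto simp: sqf_times_mem_iff[OF Z])

lemma ichain_sqf_plus: "chain i s \<Longrightarrow> ichain plus_ideal i (\<lambda>b. sqf Z * s b)"
  unfolding ichain_def chain_def
proof (intro allI impI)
  fix b assume "\<forall>b<rk i. s b \<in> polys_in V" "b < rk i"
  then have "s b \<in> polys_in V" by blast
  then show "sqf Z * s b \<in> mideal V plus_ideal"
    by (rule iffD2[OF sqf_times_mem_iff[OF Z]]) (use \<open>s b \<in> polys_in V\<close> in \<open>simp add: mideal_def\<close>)
qed

lemma ichain_division:
  assumes "hchain i j x" "ichain plus_ideal i x"
  obtains q s where "ichain P i q" "hchain i j q" "hchain i (j - int (card Z)) s"
    "\<And>b. b < rk i \<Longrightarrow> x b = q b + sqf Z * s b"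
proof -
  have "\<exists>q s. x b = q + sqf Z * s \<and> q \<in> mideal V P \<and> q \<in> hcomp V (j - sh i b)
      \<and> s \<in> hcomp V (j - sh i b - int (card Z))" if "b < rk i" for b
  proof -
    have x: "x b \<in> hcomp V (j - sh i b)" "x b \<in> mideal V plus_ideal"
      using assms that by (auto simp: hchain_def ichain_def)
    show ?thesis using x(1) by (rule_tac sqf_division[OF Z(1) x(2)]) blast
  qed
  then obtain q s where "\<And>b. b < rk i \<Longrightarrow> x b = q b + sqf Z * s b \<and> q b \<in> mideal V P
      \<and> q b \<in> hcomp V (j - sh i b) \<and> s b \<in> hcomp V (j - sh i b - int (card Z))"
    by metis
  then show thesis
    by (intro that[of q s]) (auto simp: ichain_def hchain_def cancel_ab_semigroup_add_class.diff_right_commute[of j "int (card Z)"])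
qed

text \<open>Exactness of the long homology sequence at the middle term. Modulo a boundary and the
  ideal, a cycle \<open>x\<close> becomes \<open>sqf Z\<close> times a cycle \<open>s\<close> of the
  colon quotient; bounding \<open>s\<close> there bounds \<open>x\<close>.\<close>

lemma van_middle:
  assumes "van colon i (j - int (card Z))" "van plus_ideal i j"
  shows "van P i j"
  unfolding van_def
proof (intro allI impI)
  fix x assume x: "cyc P i j x"
  then have hx: "hchain i j x" by (simp add: cyc_def)
  have c: "cyc plus_ideal i j x"
    using x unfolding cyc_def by (auto split: nat.split intro: ichain_mono[of P])
  obtain y u where y: "hchain (Suc i) j y" "ichain plus_ideal i u" "hchain i j u"
    "\<And>b. b < rk i \<Longrightarrow> x b = d i y b + u b"
    by (rule vanE[OF assms(2) c]) blast
  obtain q s where q: "ichain P i q" "hchain i j q" "hchain i (j - int (card Z)) s"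
    "\<And>b. b < rk i \<Longrightarrow> u b = q b + sqf Z * s b"
    by (rule ichain_division[OF y(3,2)]) blast
  have c: "cyc colon i (j - int (card Z)) s"
  proof (cases i)
    case 0
    then show ?thesis using q(3) by (simp add: cyc_def)
  next
    case (Suc k)
    have "ichain P k (\<lambda>c. d k x c - d k q c)"
      using x q(1) P Suc by (auto simp: cyc_def intro!: ichain_diff d_ichain)
    moreover have "d k x c - d k q c = sqf Z * d k s c" if "c < rk k" for c
    proof -
      have "d k x c = d k (\<lambda>b. d i y b + (q b + sqf Z * s b)) c"
        using y(4) q(4) Suc by (intro d_cong) simp
      moreover have "d k (d i y) c = 0"
        using dd[of k y c] y(1) that Suc by (simp add: hchain_chain)
      ultimately show ?thesis by (simp add: d_add d_mult)
    qed
    ultimately have "ichain P k (\<lambda>c. sqf Z * d k s c)" by (rule ichain_cong)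
    moreover have "chain k (d k s)" using q(3) Suc by (auto intro: d_chain hchain_chain)
    ultimately show ?thesis using q(3) Suc by (simp add: cyc_def ichain_sqf)
  qed
  obtain z t where z: "hchain (Suc i) (j - int (card Z)) z" "ichain colon i t"
      "hchain i (j - int (card Z)) t" "\<And>b. b < rk i \<Longrightarrow> s b = d i z b + t b"
    by (rule vanE[OF assms(1) c]) blast
  show "bdry P i j x"
  proof (rule bdryI)
    show "hchain (Suc i) j (\<lambda>b. y b + sqf Z * z b)"
      by (intro hchain_add hchain_sqf y z)
    show "ichain P i (\<lambda>b. q b + sqf Z * t b)"
      using z(2,3) by (intro ichain_add q) (simp add: ichain_sqf hchain_chain)
    show "x b = d i (\<lambda>b. y b + sqf Z * z b) b + (q b + sqf Z * t b)" if "b < rk i" for b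
      using that y(4) q(4) z(4) by (simp add: d_add d_mult algebra_simps)
  qed
qed

text \<open>Exactness at the right term: if the connecting map kills the class of \<open>x\<close>,
  then \<open>x\<close> can be corrected by a multiple of \<open>sqf Z\<close> to a cycle modulo
  \<open>P\<close>. In homological degree 0 there is no connecting map, which is why the second
  premise is conditional.\<close>

lemma van_right:
  assumes "van P i j" "\<And>k. i = Suc k \<Longrightarrow> van colon k (j - int (card Z))"
  shows "van plus_ideal i j"
  unfolding van_def
proof (intro allI impI)
  fix x assume x: "cyc plus_ideal i j x"
  then have hx: "hchain i j x" by (simp add: cyc_def)
  have "\<exists>z. hchain i (j - int (card Z)) z \<and> cyc P i j (\<lambda>b. x b - sqf Z * z b)"
  proof (cases i)
    case 0
    then show ?thesis using hx by (intro exI[of _ "\<lambda>_. 0"]) (simp add: cyc_def hchain_def)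
  next
    case (Suc k)
    have dx: "hchain k j (d k x)" "ichain plus_ideal k (d k x)"
      using x hx Suc by (simp_all add: cyc_def d_hchain)
    \<comment> \<open>Here \<open>s\<close> represents the image of \<open>x\<close> under the
      connecting homomorphism.\<close>
    obtain q s where q: "ichain P k q" "hchain k j q" "hchain k (j - int (card Z)) s"
      "\<And>b. b < rk k \<Longrightarrow> d k x b = q b + sqf Z * s b"
      by (rule ichain_division[OF dx]) blast
    have c: "cyc colon k (j - int (card Z)) s"
    proof (cases k)
      case 0
      then show ?thesis using q(3) by (simp add: cyc_def)
    next
      case (Suc l)
      have "ichain P l (\<lambda>c. - d l q c)"
        using q(1) P Suc by (auto intro!: ichain_uminus d_ichain)
      moreover have "- d l q c = sqf Z * d l s c" if "c < rk l" for c
      proof -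
        have "d l (d k x) c = d l (\<lambda>b. q b + sqf Z * s b) c"
          using q(4) Suc by (intro d_cong) simp
        moreover have "d l (d k x) c = 0"
          using dd[of l x c] hx that Suc \<open>i = Suc k\<close> by (simp add: hchain_chain)
        ultimately show ?thesis by (simp add: d_add d_mult neg_eq_iff_add_eq_0)
      qed
      ultimately have "ichain P l (\<lambda>c. sqf Z * d l s c)" by (rule ichain_cong)
      moreover have "chain l (d l s)" using q(3) Suc by (auto intro: d_chain hchain_chain)
      ultimately show ?thesis using q(3) Suc by (simp add: cyc_def ichain_sqf)
    qed
    obtain z t where z: "hchain (Suc k) (j - int (card Z)) z" "ichain colon k t"
      "hchain k (j - int (card Z)) t" "\<And>b. b < rk k \<Longrightarrow> s b = d k z b + t b"
      by (rule vanE[OF assms(2)[OF Suc] c]) blast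
    have "ichain P k (\<lambda>b. q b + sqf Z * t b)"
      using z(2,3) by (intro ichain_add q) (simp add: ichain_sqf hchain_chain)
    moreover have "q b + sqf Z * t b = d k (\<lambda>b. x b - sqf Z * z b) b" if "b < rk k" for b
      using that q(4) z(4) by (simp add: d_diff d_mult algebra_simps)
    ultimately have "ichain P k (d k (\<lambda>b. x b - sqf Z * z b))" by (rule ichain_cong)
    moreover have "hchain i j (\<lambda>b. x b - sqf Z * z b)"
      using hx z(1) Suc by (auto intro!: hchain_diff hchain_sqf)
    ultimately show ?thesis using z(1) Suc by (auto simp: cyc_def)
  qed
  then obtain z where z: "hchain i (j - int (card Z)) z" "cyc P i j (\<lambda>b. x b - sqf Z * z b)"
    by blast
  obtain y u where y: "hchain (Suc i) j y" "ichain P i u"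
    "\<And>b. b < rk i \<Longrightarrow> x b - sqf Z * z b = d i y b + u b"
    by (rule vanE[OF assms(1) z(2)]) blast
  have "ichain plus_ideal i (\<lambda>b. sqf Z * z b)"
    using z(1) by (intro ichain_sqf_plus hchain_chain)
  then have "ichain plus_ideal i (\<lambda>b. u b + sqf Z * z b)"
    using y(2) by (auto intro: ichain_add ichain_mono[of P])
  then show "bdry plus_ideal i j x"
    using y(1,3) by (auto intro!: bdryI simp: algebra_simps)
qed

text \<open>Exactness at the left term: if \<open>sqf Z * s\<close> is the boundary of
  \<open>y\<close> modulo \<open>P\<close>, then \<open>y\<close> is a cycle for the larger ideal,
  and the class of \<open>s\<close> is its image under the connecting map. Once \<open>y\<close>
  bounds, so does \<open>s\<close>.\<close>

lemma van_left:
  assumes "van P i j" "van plus_ideal (Suc i) j"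
  shows "van colon i (j - int (card Z))"
  unfolding van_def
proof (intro allI impI)
  fix s assume s: "cyc colon i (j - int (card Z)) s"
  then have hs: "hchain i (j - int (card Z)) s" by (simp add: cyc_def)
  have c: "cyc P i j (\<lambda>b. sqf Z * s b)"
  proof (cases i)
    case (Suc k)
    have "chain k (d k s)" using hs Suc by (auto intro: d_chain hchain_chain)
    then have "ichain P k (\<lambda>c. sqf Z * d k s c)"
      using s Suc by (simp add: cyc_def ichain_sqf)
    then have "ichain P k (d k (\<lambda>b. sqf Z * s b))"
      by (rule ichain_cong) (simp add: d_mult)
    then show ?thesis using hs Suc by (simp add: cyc_def hchain_sqf)
  qed (use hs in \<open>simp add: cyc_def hchain_sqf\<close>)
  obtain y q where y: "hchain (Suc i) j y" "ichain P i q"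
      "\<And>b. b < rk i \<Longrightarrow> sqf Z * s b = d i y b + q b"
    by (rule vanE[OF assms(1) c]) blast
  have "ichain plus_ideal i (\<lambda>b. sqf Z * s b - q b)"
    using hs y(2) by (intro ichain_diff ichain_sqf_plus) (auto intro: hchain_chain ichain_mono[of P])
  then have "ichain plus_ideal i (d i y)"
    by (rule ichain_cong) (use y(3) in auto)
  then have c: "cyc plus_ideal (Suc i) j y" using y(1) by (simp add: cyc_def)
  obtain z u where z: "hchain (Suc (Suc i)) j z" "ichain plus_ideal (Suc i) u"
      "hchain (Suc i) j u" "\<And>b. b < rk (Suc i) \<Longrightarrow> y b = d (Suc i) z b + u b"
    by (rule vanE[OF assms(2) c]) blast
  obtain q' t where t: "ichain P (Suc i) q'" "hchain (Suc i) j q'"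
      "hchain (Suc i) (j - int (card Z)) t" "\<And>b. b < rk (Suc i) \<Longrightarrow> u b = q' b + sqf Z * t b"
    by (rule ichain_division[OF z(3,2)]) blast
  \<comment> \<open>Substituting the expression for \<open>y\<close> turns this element of the ideal
    into a multiple of \<open>sqf Z\<close>; cancelling the monomial shows that \<open>s\<close> is
    the boundary of \<open>t\<close> modulo the colon ideal.\<close>
  have "ichain P i (\<lambda>b. d i q' b + q b)"
    by (rule ichain_add[OF d_ichain[OF P t(1)] y(2)])
  moreover have "d i q' b + q b = sqf Z * (s b - d i t b)" if "b < rk i" for b
  proof -
    have "d i y b = d i (\<lambda>b. d (Suc i) z b + (q' b + sqf Z * t b)) b"
      using z(4) t(4) by (intro d_cong) simp
    moreover have "d i (d (Suc i) z) b = 0" using z(1) that by (simp add: dd hchain_chain)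
    ultimately show ?thesis using y(3)[OF that] by (simp add: d_add d_mult algebra_simps)
  qed
  ultimately have "ichain P i (\<lambda>b. sqf Z * (s b - d i t b))" by (rule ichain_cong)
  then have "ichain colon i (\<lambda>b. s b - d i t b)"
    using hchain_chain[OF hchain_diff[OF hs d_hchain[OF t(3)]]] ichain_sqf by blast
  then show "bdry colon i (j - int (card Z)) s"
    using t(3) by (auto simp: bdry_def)
qed

end

end

section \<open>Extremal corners of the Betti table\<close>

context field_resolution
begin

text \<open>The Betti table of \<open>S/I\<close> lives in the strands \<open>0, \<dots>, r\<close>, and \<open>p\<close> is the largest homological
  degree in which strand \<open>r\<close> is nonzero.\<close>

definition corner :: "('v set \<Rightarrow> bool) \<Rightarrow> nat \<Rightarrow> nat \<Rightarrow> bool" where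
  "corner P r p \<longleftrightarrow> mono P \<and> (\<forall>i j. j < int i \<longrightarrow> van P i j) \<and>
     (\<forall>i j. j > int i + int r \<longrightarrow> van P i j) \<and> (\<forall>i>p. van P i (int i + int r)) \<and>
     \<not> van P p (int p + int r)"

lemma corner_mono: "corner P r p \<Longrightarrow> mono P"
  by (simp add: corner_def)

lemma corner_below: "corner P r p \<Longrightarrow> j < int i \<Longrightarrow> van P i j"
  by (simp add: corner_def)

lemma corner_above: "corner P r p \<Longrightarrow> j > int i + int r \<Longrightarrow> van P i j"
  by (simp add: corner_def)

lemma corner_right: "corner P r p \<Longrightarrow> i > p \<Longrightarrow> van P i (int i + int r)"
  by (simp add: corner_def)

lemma corner_at: "corner P r p \<Longrightarrow> \<not> van P p (int p + int r)"
  by (simp add: corner_def)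

text \<open>For the zero ideal the tensor product is \<open>F\<close> itself, whose only homology is
  \<open>K\<close> in homological and internal degree 0.\<close>

lemma corner_zero: "corner (\<lambda>_. False) 0 0"
proof -
  have m: "mideal V (\<lambda>_. False) = {0 :: ('v, 'k) mpoly}"
    by (auto simp: mideal_def intro: poly_mapping_eqI simp flip: keys_eq_empty)
  have ic: "ichain (\<lambda>_. False) i u \<longleftrightarrow> (\<forall>b<rk i. u b = 0)" for i u
    by (simp add: ichain_def m)
  have pos: "van (\<lambda>_. False) (Suc i) j" for i j
    unfolding van_def
  proof (intro allI impI)
    fix x assume x: "cyc (\<lambda>_. False) (Suc i) j x"
    then have hx: "hchain (Suc i) j x" by (simp add: cyc_def)
    obtain y where "chain (Suc (Suc i)) y" "\<forall>b<rk (Suc i). x b = d (Suc i) y b"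
      using exact[OF hchain_chain[OF hx]] x by (auto simp: cyc_def ic)
    then obtain y where "hchain (Suc (Suc i)) j y" "\<forall>b<rk (Suc i). x b = d (Suc i) y b"
      using homog_preimage[OF hx] by blast
    then show "bdry (\<lambda>_. False) (Suc i) j x" by (auto simp: bdry_def ic)
  qed
  let ?\<epsilon> = "\<lambda>x. \<Sum>b<rk 0. Poly_Mapping.lookup (x b) 0 * aug b"
  have const: "Poly_Mapping.lookup (hpart j (p :: ('v, 'k) mpoly)) 0 = (if j = 0 then Poly_Mapping.lookup p 0 else 0)" for j p
    by (simp add: hpart_def lookup_pfilter)
  have z: "van (\<lambda>_. False) 0 j" if "j \<noteq> 0" for j
    unfolding van_def
  proof (intro allI impI)
    fix x assume "cyc (\<lambda>_. False) 0 j x"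
    then have hx: "hchain 0 j x" by (simp add: cyc_def)
    \<comment> \<open>A generator with nonzero augmentation has degree 0, so its coefficient has
      degree \<open>j\<close>, which is not 0, and lacks a constant term.\<close>
    have "Poly_Mapping.lookup (x b) 0 * aug b = 0" if "b < rk 0" for b
    proof (cases "aug b = 0")
      case False
      then have "sh 0 b = 0" using aug_homog that by blast
      moreover have "x b \<in> hcomp V (j - sh 0 b)" using hx that by (simp add: hchain_def)
      ultimately have "hpart j (x b) = x b" by (simp add: hpart_id)
      then show ?thesis using const[of j "x b"] \<open>j \<noteq> 0\<close> by simp
    qed simp
    then have "?\<epsilon> x = 0" by (intro sum.neutral) auto
    then obtain y where "chain (Suc 0) y" "\<forall>b<rk 0. x b = d 0 y b"
      using aug_exact[OF hchain_chain[OF hx]] by auto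
    then obtain y where "hchain (Suc 0) j y" "\<forall>b<rk 0. x b = d 0 y b"
      using homog_preimage[OF hx] by blast
    then show "bdry (\<lambda>_. False) 0 j x" by (auto simp: bdry_def ic)
  qed
  have nz: "\<not> van (\<lambda>_. False) 0 0"
  proof
    assume v: "van (\<lambda>_. False) 0 0"
    obtain x where x: "chain 0 x" "?\<epsilon> x = 1" using aug_surj by blast
    \<comment> \<open>The augmentation only sees degree 0, so the preimage of 1 may be taken
      homogeneous.\<close>
    define x' where "x' = (\<lambda>b. hpart (0 - sh 0 b) (x b))"
    have hx: "hchain 0 0 x'" unfolding x'_def by (rule hchain_hpart) (rule x)
    have "Poly_Mapping.lookup (x' b) 0 * aug b = Poly_Mapping.lookup (x b) 0 * aug b" if "b < rk 0" for b
      using aug_homog[OF that] by (auto simp: x'_def const)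
    then have "?\<epsilon> x' = ?\<epsilon> x" by (intro sum.cong) auto
    then have "?\<epsilon> x' = 1" using x(2) by simp
    moreover have "bdry (\<lambda>_. False) 0 0 x'" using v hx by (simp add: van_def cyc_def)
    then have "\<exists>y. chain (Suc 0) y \<and> (\<forall>b<rk 0. x' b = d 0 y b)"
      by (auto simp: bdry_def ic intro: hchain_chain)
    then have "?\<epsilon> x' = 0" using aug_exact[OF hchain_chain[OF hx]] by blast
    ultimately show False by simp
  qed
  have v: "van (\<lambda>_. False) i j" if "i \<noteq> 0 \<or> j \<noteq> 0" for i j
    using that pos z by (cases i) auto
  then show ?thesis using nz by (auto simp: corner_def mono_def intro!: v)
qed

text \<open>By \<open>ind\<close> the colon ideal is the ideal itself, that is, \<open>sqf Z\<close>
  is a nonzerodivisor on the quotient. The connecting map moves the corner one homological degree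
  and \<open>card Z\<close> internal degrees up, hence the strand by
  \<open>card Z - 1\<close>.\<close>

lemma corner_regular:
  assumes c: "corner P r p" and Z: "finite Z" "Z \<subseteq> V" "Z \<noteq> {}" and ind: "\<And>A. P (A \<union> Z) = P A"
  shows "corner (\<lambda>A. P A \<or> Z \<subseteq> A) (r + card Z - 1) (Suc p)"
proof -
  let ?P = "\<lambda>A. P A \<or> Z \<subseteq> A"
  note P = corner_mono[OF c]
  have d: "card Z \<ge> 1" using Z by (simp add: Suc_le_eq card_gt_0_iff)
  note R = van_right[OF P Z(1,2), unfolded ind] and L = van_left[OF P Z(1,2), unfolded ind]
  have below: "van ?P i j" if "j < int i" for i j
    using that d by (intro R corner_below[OF c]) auto
  have above: "van ?P i j" if "j > int i + int (r + card Z - 1)" for i j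
    using that d by (intro R corner_above[OF c]) auto
  have right: "van ?P i (int i + int (r + card Z - 1))" if "i > Suc p" for i
  proof (rule R)
    \<comment> \<open>For a single variable this is strand \<open>r\<close>, to the right of the
      corner; for larger \<open>Z\<close> the strand already lies above \<open>r\<close>.\<close>
    show "van P i (int i + int (r + card Z - 1))"
      using that d corner_above[OF c, of i "int i + int (r + card Z - 1)"] corner_right[OF c, of i]
      by (cases "card Z = 1") auto
    show "van P k (int i + int (r + card Z - 1) - int (card Z))" if "i = Suc k" for k
      using corner_right[OF c, of k] \<open>i > Suc p\<close> that d by (simp add: of_nat_diff algebra_simps)
  qed
  have "\<not> van ?P (Suc p) (int (Suc p) + int (r + card Z - 1))"
  proof
    assume "van ?P (Suc p) (int (Suc p) + int (r + card Z - 1))"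
    then have "van P p (int (Suc p) + int (r + card Z - 1) - int (card Z))"
      using d by (intro L corner_above[OF c]) auto
    then show False using corner_at[OF c] d by (simp add: of_nat_diff algebra_simps)
  qed
  then show ?thesis
    using below above right mono_plus[OF P Z(1,2)] by (auto simp: corner_def)
qed

lemma corner_var:
  assumes "corner P r p" "x \<in> V" "\<And>A. P (insert x A) = P A"
  shows "corner (\<lambda>A. P A \<or> x \<in> A) r (Suc p)"
  using corner_regular[OF assms(1), of "{x}"] assms(2,3) by simp

lemma corner_edge:
  assumes "corner P r p" "x \<in> V" "y \<in> V" "x \<noteq> y" "\<And>A. P (insert x A) = P A" "\<And>A. P (insert y A) = P A"
  shows "corner (\<lambda>A. P A \<or> {x, y} \<subseteq> A) (Suc r) (Suc p)"
  using corner_regular[OF assms(1), of "{x, y}"] assms(2-) by simp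

text \<open>In the next two lemmas a vertex \<open>x\<close> with neighbourhood \<open>N\<close> is added to a graph with
  nonface predicate \<open>Q\<close>; colon and sum with respect to \<open>x\<close> are the outer terms.\<close>

lemma corner_vertex_left:
  assumes N: "corner (\<lambda>A. Q A \<or> A \<inter> N \<noteq> {}) r p'" and c: "corner Q r p" and x: "x \<in> V" "x \<notin> N"
    and ind: "\<And>A. Q (insert x A) = Q A" and p: "p < p'"
  shows "corner (\<lambda>A. Q A \<or> x \<in> A \<and> A \<inter> N \<noteq> {}) (Suc r) p'"
proof -
  let ?P = "\<lambda>A. Q A \<or> x \<in> A \<and> A \<inter> N \<noteq> {}"
  have P: "mono ?P" using corner_mono[OF c] by (intro monoI) (auto dest: monoD)
  have colon: "(\<lambda>A. ?P (A \<union> {x})) = (\<lambda>A. Q A \<or> A \<inter> N \<noteq> {})" using x(2) ind by (auto simp: fun_eq_iff)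
  have plus: "(\<lambda>A. ?P A \<or> {x} \<subseteq> A) = (\<lambda>A. Q A \<or> x \<in> A)" by (auto simp: fun_eq_iff)
  have Z: "finite {x}" "{x} \<subseteq> V" using x by auto
  note c2 = corner_var[OF c x(1) ind]
  note M = van_middle[OF P Z, unfolded colon plus] and L = van_left[OF P Z, unfolded colon plus]
  have "van ?P i j" if "j < int i" for i j
    using that by (intro M corner_below[OF N] corner_below[OF c2]) auto
  moreover have "van ?P i j" if "j > int i + int (Suc r)" for i j
    using that by (intro M corner_above[OF N] corner_above[OF c2]) auto
  moreover have "van ?P i (int i + int (Suc r))" if "i > p'" for i
    using corner_right[OF N that] corner_above[OF c2, of i "int i + int (Suc r)"] by (intro M) auto
  moreover have "\<not> van ?P p' (int p' + int (Suc r))"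
  proof
    assume v: "van ?P p' (int p' + int (Suc r))"
    \<comment> \<open>The source of the connecting map into the corner of the colon term: it lies in
      strand \<open>r\<close> of the sum term, which ends at \<open>Suc p\<close> and hence before
      \<open>Suc p'\<close>. So that corner survives.\<close>
    have "van (\<lambda>A. Q A \<or> x \<in> A) (Suc p') (int p' + int (Suc r))"
      using corner_right[OF c2, of "Suc p'"] p by (simp add: algebra_simps)
    from L[OF v this] show False using corner_at[OF N] by simp
  qed
  ultimately show ?thesis using P unfolding corner_def by blast
qed

lemma corner_vertex_right:
  assumes N: "corner (\<lambda>A. Q A \<or> A \<inter> N \<noteq> {}) r' p'" and c: "corner Q r p" and x: "x \<in> V" "x \<notin> N"
    and ind: "\<And>A. Q (insert x A) = Q A" and r: "r' < r" and p: "Suc r' < r \<or> p' \<le> Suc p"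
  shows "corner (\<lambda>A. Q A \<or> x \<in> A \<and> A \<inter> N \<noteq> {}) r (Suc p)"
proof -
  let ?P = "\<lambda>A. Q A \<or> x \<in> A \<and> A \<inter> N \<noteq> {}"
  have P: "mono ?P" using corner_mono[OF c] by (intro monoI) (auto dest: monoD)
  have colon: "(\<lambda>A. ?P (A \<union> {x})) = (\<lambda>A. Q A \<or> A \<inter> N \<noteq> {})" using x(2) ind by (auto simp: fun_eq_iff)
  have plus: "(\<lambda>A. ?P A \<or> {x} \<subseteq> A) = (\<lambda>A. Q A \<or> x \<in> A)" by (auto simp: fun_eq_iff)
  have Z: "finite {x}" "{x} \<subseteq> V" using x by auto
  note c2 = corner_var[OF c x(1) ind]
  note M = van_middle[OF P Z, unfolded colon plus] and R = van_right[OF P Z, unfolded colon plus]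
  have "van ?P i j" if "j < int i" for i j
    using that by (intro M corner_below[OF N] corner_below[OF c2]) auto
  moreover have "van ?P i j" if "j > int i + int r" for i j
    using that r by (intro M corner_above[OF N] corner_above[OF c2]) auto
  moreover have "van ?P i (int i + int r)" if "i > Suc p" for i
  proof (rule M)
    \<comment> \<open>The shifted colon term stays below strand \<open>r\<close> if
      \<open>Suc r' < r\<close>; if \<open>Suc r' = r\<close> it reaches this strand, but only up to
      homological degree \<open>p'\<close>.\<close>
    show "van (\<lambda>A. Q A \<or> A \<inter> N \<noteq> {}) i (int i + int r - int (card {x}))"
      using corner_above[OF N, of i "int i + int r - 1"] corner_right[OF N, of i] p r that
      by (cases "Suc r' = r") auto
    show "van (\<lambda>A. Q A \<or> x \<in> A) i (int i + int r)" using corner_right[OF c2 that] .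
  qed
  moreover have "\<not> van ?P (Suc p) (int (Suc p) + int r)"
  proof
    assume "van ?P (Suc p) (int (Suc p) + int r)"
    \<comment> \<open>The connecting map sends the corner of the sum term into strand
      \<open>r\<close> of the colon term, which is zero because \<open>r' < r\<close>; hence the
      corner lifts.\<close>
    then have "van (\<lambda>A. Q A \<or> x \<in> A) (Suc p) (int (Suc p) + int r)"
      using r by (intro R corner_above[OF N]) auto
    then show False using corner_at[OF c2] by simp
  qed
  ultimately show ?thesis using P unfolding corner_def by blast
qed

lemma corner_vars:
  assumes "finite W" "corner P r p" "W \<subseteq> V" "\<And>x A. x \<in> W \<Longrightarrow> P (insert x A) = P A"
  shows "corner (\<lambda>A. P A \<or> A \<inter> W \<noteq> {}) r (p + card W)"
  using assms
proof (induction W rule: finite_induct)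
  case (insert x W)
  have "corner (\<lambda>A. (P A \<or> A \<inter> W \<noteq> {}) \<or> x \<in> A) r (Suc (p + card W))"
    using insert by (intro corner_var) auto
  moreover have "(\<lambda>A. (P A \<or> A \<inter> W \<noteq> {}) \<or> x \<in> A) = (\<lambda>A. P A \<or> A \<inter> insert x W \<noteq> {})"
    by (auto simp: fun_eq_iff)
  ultimately show ?case using insert.hyps by simp
qed simp

text \<open>Starting from the edge \<open>v3 v4\<close>, the vertex \<open>v2\<close> gives the path
  \<open>v1 v2 v3 v4\<close> and \<open>v0\<close> closes the cycle. In the last step the sum term
  is the path with \<open>p + 2\<close>, and the colon term is an edge plus two variables with
  \<open>p + 3\<close>, both in strand \<open>r + 1\<close>. The strict inequality between these
  degrees is what raises the strand.\<close>

lemma corner_five_cycle: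
  assumes c: "corner P r p" and V: "{v0, v1, v2, v3, v4} \<subseteq> V" and dist: "distinct [v0, v1, v2, v3, v4]"
    and ind: "\<And>x A. x \<in> {v0, v1, v2, v3, v4} \<Longrightarrow> P (insert x A) = P A"
  shows "corner (\<lambda>A. P A \<or> {v0, v1} \<subseteq> A \<or> {v1, v2} \<subseteq> A \<or> {v2, v3} \<subseteq> A \<or> {v3, v4} \<subseteq> A \<or> {v4, v0} \<subseteq> A)
    (r + 2) (p + 3)"
proof -
  let ?Q3 = "\<lambda>A. P A \<or> {v3, v4} \<subseteq> A"
  let ?Q2 = "\<lambda>A. ?Q3 A \<or> v2 \<in> A \<and> A \<inter> {v1, v3} \<noteq> {}"
  have v34: "corner ?Q3 (Suc r) (Suc p)"
    using c V dist ind by (intro corner_edge) auto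
  have "corner (\<lambda>A. P A \<or> A \<inter> {v1, v3} \<noteq> {}) r (p + card {v1, v3})"
    using c V ind by (intro corner_vars) auto
  \<comment> \<open>The edge \<open>v3 v4\<close> is absorbed by the variable
    \<open>v3\<close>.\<close>
  moreover have "(\<lambda>A. P A \<or> A \<inter> {v1, v3} \<noteq> {}) = (\<lambda>A. ?Q3 A \<or> A \<inter> {v1, v3} \<noteq> {})"
    by (auto simp: fun_eq_iff)
  ultimately have "corner (\<lambda>A. ?Q3 A \<or> A \<inter> {v1, v3} \<noteq> {}) r (p + card {v1, v3})"
    by (simp only:)
  from corner_vertex_right[OF this v34, of v2] have path: "corner ?Q2 (Suc r) (Suc (Suc p))"
    using V dist ind by auto
  \<comment> \<open>Once the neighbours \<open>v1\<close> and \<open>v4\<close> of \<open>v0\<close>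
    are variables of the ideal, only the edge \<open>v2 v3\<close> of the path is left.\<close>
  have "corner (\<lambda>A. (P A \<or> {v2, v3} \<subseteq> A) \<or> A \<inter> {v1, v4} \<noteq> {}) (Suc r) (Suc p + card {v1, v4})"
    using c V dist ind by (intro corner_vars corner_edge) auto
  moreover have "(\<lambda>A. (P A \<or> {v2, v3} \<subseteq> A) \<or> A \<inter> {v1, v4} \<noteq> {}) = (\<lambda>A. ?Q2 A \<or> A \<inter> {v1, v4} \<noteq> {})"
    by (auto simp: fun_eq_iff)
  ultimately have "corner (\<lambda>A. ?Q2 A \<or> A \<inter> {v1, v4} \<noteq> {}) (Suc r) (Suc p + card {v1, v4})"
    by (simp only:)
  from corner_vertex_left[OF this path, of v0]
  have "corner (\<lambda>A. ?Q2 A \<or> v0 \<in> A \<and> A \<inter> {v1, v4} \<noteq> {}) (Suc (Suc r)) (Suc (Suc (Suc p)))"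
    using V dist ind by auto
  moreover have "(\<lambda>A. ?Q2 A \<or> v0 \<in> A \<and> A \<inter> {v1, v4} \<noteq> {}) =
    (\<lambda>A. P A \<or> {v0, v1} \<subseteq> A \<or> {v1, v2} \<subseteq> A \<or> {v2, v3} \<subseteq> A \<or> {v3, v4} \<subseteq> A \<or> {v4, v0} \<subseteq> A)"
    by (auto simp: fun_eq_iff)
  ultimately show ?thesis by (simp add: numeral_3_eq_3)
qed

text \<open>A further clique vertex is adjacent to all earlier ones, so its colon term consists of
  variables on top of \<open>P\<close> and stays in strand \<open>r\<close>. It ends in degree
  \<open>p + card W\<close>, the borderline case allowed by
  \<open>corner_vertex_right\<close>.\<close>

lemma corner_clique:
  assumes c: "corner P r p" and W: "finite W" "W \<subseteq> V" "card W \<ge> 2"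
    and ind: "\<And>x A. x \<in> W \<Longrightarrow> P (insert x A) = P A"
  shows "corner (\<lambda>A. P A \<or> (\<exists>x\<in>W. \<exists>y\<in>W. x \<noteq> y \<and> {x, y} \<subseteq> A)) (Suc r) (p + card W - 1)"
  using W ind
proof (induction W rule: finite_induct)
  case (insert x W)
  let ?Q = "\<lambda>W A. P A \<or> (\<exists>x\<in>W. \<exists>y\<in>W. x \<noteq> y \<and> {x, y} \<subseteq> A)"
  show ?case
  proof (cases "card W \<ge> 2")
    case True
    have "corner (\<lambda>A. P A \<or> A \<inter> W \<noteq> {}) r (p + card W)"
      using insert c by (intro corner_vars) auto
    moreover have "(\<lambda>A. P A \<or> A \<inter> W \<noteq> {}) = (\<lambda>A. ?Q W A \<or> A \<inter> W \<noteq> {})"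
      by (auto simp: fun_eq_iff)
    moreover have "corner (?Q W) (Suc r) (p + card W - 1)" using insert True by auto
    ultimately have "corner (\<lambda>A. ?Q W A \<or> x \<in> A \<and> A \<inter> W \<noteq> {}) (Suc r) (Suc (p + card W - 1))"
      using insert True by (intro corner_vertex_right[where p' = "p + card W" and r' = r]) auto
    moreover have "(\<lambda>A. ?Q W A \<or> x \<in> A \<and> A \<inter> W \<noteq> {}) = ?Q (insert x W)"
      using insert.hyps by (auto simp: fun_eq_iff)
    ultimately show ?thesis using insert.hyps True by simp
  next
    case False
    then have "card W = 1" using insert by simp
    then obtain y where W: "W = {y}" by (auto simp: card_Suc_eq)
    have "corner (\<lambda>A. P A \<or> {x, y} \<subseteq> A) (Suc r) (Suc p)"
      using insert c W by (intro corner_edge) auto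
    moreover have "(\<lambda>A. P A \<or> {x, y} \<subseteq> A) = ?Q (insert x W)"
      using insert.hyps W by (auto simp: fun_eq_iff)
    ultimately show ?thesis using insert.hyps W by simp
  qed
qed simp

end

section \<open>The Koszul complex\<close>

text \<open>A resolution of the quotient by the variables in \<open>W\<close>, with \<open>F\<close>
  in degree 0 equal to the polynomial ring. Exactness there is phrased through
  \<open>mideal\<close>, so that membership after multiplication by a new variable can be read off
  supports.\<close>

locale koszul_complex = free_cplx V rk sh D
  for V :: "'v set" and rk sh and D :: "nat \<Rightarrow> nat \<Rightarrow> nat \<Rightarrow> ('v, 'k::field) mpoly" +
  fixes W :: "'v set"
  assumes rk0: "rk 0 = 1" and sh0: "sh 0 0 = 0"
    and homog: "c < rk i \<Longrightarrow> b < rk (Suc i) \<Longrightarrow> D i c b \<in> hcomp V (sh (Suc i) b - sh i c)"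
    and dd: "chain (Suc (Suc i)) x \<Longrightarrow> c < rk i \<Longrightarrow> d i (d (Suc i) x) c = 0"
    and exact: "chain (Suc i) x \<Longrightarrow> (\<And>c. c < rk i \<Longrightarrow> d i x c = 0) \<Longrightarrow>
      \<exists>y. chain (Suc (Suc i)) y \<and> (\<forall>b<rk (Suc i). x b = d (Suc i) y b)"
    and image: "p \<in> polys_in V \<Longrightarrow>
      p \<in> mideal V (\<lambda>A. A \<inter> W \<noteq> {}) \<longleftrightarrow> (\<exists>y. chain (Suc 0) y \<and> p = d 0 y 0)"

lemma koszul_complex_empty:
  "koszul_complex V (\<lambda>i. if i = 0 then 1 else 0) (\<lambda>_ _. 0) (\<lambda>_ _ _. 0 :: ('v, 'k::field) mpoly) {}"
proof -
  interpret free_cplx V "\<lambda>i. if i = 0 then 1 else 0" "\<lambda>_ _. 0"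
    "\<lambda>_ _ _. 0 :: ('v, 'k) mpoly" .
  have m: "mideal V (\<lambda>_. False) = {0 :: ('v, 'k) mpoly}"
    by (auto simp: mideal_def intro: poly_mapping_eqI simp flip: keys_eq_empty)
  show ?thesis by unfold_locales (auto simp: d_def chain_def m)
qed

lemma sum_lessThan_add:
  "(\<Sum>b<m + n. f b) = (\<Sum>b<m. f b) + (\<Sum>b<n. f (m + b :: nat) :: 'a::comm_monoid_add)"
  by (induction n) (auto simp: add_ac)

lemma less_add_cases:
  fixes b m n :: nat
  assumes "b < m + n"
  obtains "b < m" | b' where "b = m + b'" "b' < n"
  using assms by (metis less_diff_conv2 add.commute add_diff_inverse_nat not_less)

text \<open>The mapping cone of multiplication by the variable \<open>w\<close>.\<close>

context koszul_complex
begin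

definition crk :: "nat \<Rightarrow> nat" where
  "crk i = (case i of 0 \<Rightarrow> rk 0 | Suc k \<Rightarrow> rk (Suc k) + rk k)"

definition csh :: "nat \<Rightarrow> nat \<Rightarrow> int" where
  "csh i b = (if b < rk i then sh i b else sh (i - 1) (b - rk i) + 1)"

text \<open>The block matrix with \<open>D\<close> and multiplication by \<open>w\<close> in the
  upper row, 0 and \<open>- D\<close> in the lower one; the sign makes consecutive maps compose to
  0. The second block starts in homological degree 1, so \<open>i - 1\<close> is never truncated on
  valid indices.\<close>

definition cD :: "'v \<Rightarrow> nat \<Rightarrow> nat \<Rightarrow> nat \<Rightarrow> ('v, 'k) mpoly" where
  "cD w i c b = (if b < rk (Suc i) then if c < rk i then D i c b else 0
     else if c < rk i then if c = b - rk (Suc i) then sqf {w} else 0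
     else - D (i - 1) (c - rk i) (b - rk (Suc i)))"

text \<open>A new variable is a nonzerodivisor modulo the variables in \<open>W\<close>, so the cone
  has no homology in positive degrees.\<close>

lemma koszul_complex_insert:
  assumes w: "w \<in> V" "w \<notin> W"
  shows "koszul_complex V crk csh (cD w) (insert w W)"
proof -
  interpret c: free_cplx V crk csh "cD w" .
  let ?w = "sqf {w} :: ('v, 'k) mpoly"
  have w_mem: "?w \<in> hcomp V 1" using sqf_mem[of "{w}" V] w by simp
  have crk_simps: "crk 0 = rk 0" "crk (Suc i) = rk (Suc i) + rk i" for i
    by (simp_all add: crk_def)
  have chain_iff: "c.chain (Suc i) x \<longleftrightarrow> chain (Suc i) x \<and> chain i (\<lambda>b. x (rk (Suc i) + b))" for i x
    unfolding c.chain_def chain_def crk_simps by (auto elim: less_add_cases)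
  have chain0: "c.chain 0 x \<longleftrightarrow> chain 0 x" for x
    by (simp add: c.chain_def chain_def crk_simps)
  have d_top: "c.d i x c = d i x c + ?w * x (rk (Suc i) + c)" if "c < rk i" for i x c
    using that by (simp add: c.d_def d_def crk_simps sum_lessThan_add cD_def if_distrib[of "\<lambda>t. t * _"] cong: if_cong)
  have d_bot: "c.d (Suc k) x (rk (Suc k) + c) = - d k (\<lambda>b. x (rk (Suc (Suc k)) + b)) c" for k x c
    by (simp add: c.d_def d_def crk_simps sum_lessThan_add cD_def sum_negf)
  show ?thesis
  proof
    show "crk 0 = 1" by (simp add: crk_simps rk0)
    show "csh 0 0 = 0" by (simp add: csh_def rk0 sh0)
  next
    fix c i b assume c: "c < crk i" and b: "b < crk (Suc i)"
    have b': "b < rk (Suc i) + rk i" using b by (simp add: crk_simps)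
    show "cD w i c b \<in> hcomp V (csh (Suc i) b - csh i c)"
    proof (cases "c < rk i")
      case True
      then show ?thesis using b' homog[of c i b] w_mem by (auto simp: cD_def csh_def)
    next
      case False
      then obtain k where k: "i = Suc k" "c - rk i < rk k"
        using c by (cases i) (auto simp: crk_simps)
      show ?thesis
      proof (cases "b < rk (Suc i)")
        case True
        then show ?thesis using False by (simp add: cD_def)
      next
        case False': False
        then have "b - rk (Suc i) < rk (Suc k)" using b' k(1) by auto
        then show ?thesis using homog[OF k(2), of "b - rk (Suc i)"] False False' k(1)
          by (simp add: cD_def csh_def hcomp_uminus)
      qed
    qed
  next
    fix i x c assume x: "c.chain (Suc (Suc i)) x" and c: "c < crk i"
    let ?z = "\<lambda>b. x (rk (Suc (Suc i)) + b)"
    have xz: "chain (Suc (Suc i)) x" "chain (Suc i) ?z" using x by (simp_all add: chain_iff)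
    consider "c < rk i" | k c' where "i = Suc k" "c = rk (Suc k) + c'" "c' < rk k"
      using c by (cases i) (auto simp: crk_simps elim: less_add_cases)
    then show "c.d i (c.d (Suc i) x) c = 0"
    proof cases
      case 1
      have "d i (c.d (Suc i) x) c = d i (\<lambda>b. d (Suc i) x b + ?w * ?z b) c"
        by (intro d_cong) (simp add: d_top)
      also have "\<dots> = ?w * d i ?z c" using dd[OF xz(1) 1] by (simp add: d_add d_mult)
      finally show ?thesis using 1 by (simp add: d_top d_bot)
    next
      case 2
      have "c.d i (c.d (Suc i) x) c = - d k (\<lambda>b. - d (Suc k) ?z b) c'"
        using 2 by (simp add: d_bot)
      then show ?thesis using dd[of k ?z c'] 2 xz(2) by (simp add: d_uminus)
    qed
  next
    fix i x assume x: "c.chain (Suc i) x" and x0: "\<And>c. c < crk i \<Longrightarrow> c.d i x c = 0"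
    let ?z = "\<lambda>b. x (rk (Suc i) + b)"
    have xz: "chain (Suc i) x" "chain i ?z" using x by (simp_all add: chain_iff)
    have dx: "d i x c + ?w * ?z c = 0" if "c < rk i" for c
      using x0[of c] that d_top[OF that, of x] by (cases i) (auto simp: crk_simps)
    have "\<exists>u. chain (Suc i) u \<and> (\<forall>b<rk i. ?z b = d i u b)"
    proof (cases i)
      case (Suc k)
      have "d k ?z c = 0" if "c < rk k" for c
        using x0[of "rk (Suc k) + c"] that Suc by (simp add: crk_simps d_bot)
      then show ?thesis using exact[of k ?z] xz(2) Suc by simp
    next
      \<comment> \<open>The only place where \<open>w\<close> being a nonzerodivisor enters:
        \<open>w\<close> times the lower component lies in the ideal of \<open>W\<close>, and since
        \<open>w\<close> is not in \<open>W\<close> the component itself does.\<close>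
      case 0
      have z0: "?z 0 \<in> polys_in V" using xz(2) rk0 by (simp add: chain_def 0)
      have "?w * ?z 0 = - d 0 x 0" using dx[of 0] rk0 0 by (simp add: add_eq_0_iff)
      then have eq: "?w * ?z 0 = d 0 (\<lambda>b. - x b) 0" by (simp add: d_uminus)
      have "chain (Suc 0) (\<lambda>b. - x b)" using xz(1) 0 by (simp add: chain_def polys_in_uminus)
      then have "?w * ?z 0 \<in> mideal V (\<lambda>A. A \<inter> W \<noteq> {})"
        using eq image[of "?w * ?z 0"] polys_in_mult[OF hcomp_subset[OF w_mem] z0] by metis
      then have "?z 0 \<in> mideal V (\<lambda>A. A \<inter> W \<noteq> {})"
        using sqf_times_mem_iff[of "{w}" V "?z 0"] z0 w by auto
      then show ?thesis using image[OF z0] rk0 0 by auto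
    qed
    then obtain u where u: "chain (Suc i) u" "\<And>b. b < rk i \<Longrightarrow> ?z b = d i u b" by blast
    \<comment> \<open>Adding \<open>w * u\<close> turns the upper component into a cycle of the old
      complex; a preimage \<open>v\<close> of it paired with \<open>- u\<close> is the preimage in
      the cone.\<close>
    have "chain (Suc i) (\<lambda>b. x b + ?w * u b)"
      using u(1) xz(1) hcomp_subset[OF w_mem] by (simp add: chain_def polys_in_add polys_in_mult)
    moreover have "d i (\<lambda>b. x b + ?w * u b) c = 0" if "c < rk i" for c
      using dx[OF that] u(2)[OF that] by (simp add: d_add d_mult)
    ultimately obtain v where v: "chain (Suc (Suc i)) v"
        "\<And>b. b < rk (Suc i) \<Longrightarrow> x b + ?w * u b = d (Suc i) v b"
      using exact[of i "\<lambda>b. x b + ?w * u b"] by blast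
    let ?y = "\<lambda>b. if b < rk (Suc (Suc i)) then v b else - u (b - rk (Suc (Suc i)))"
    show "\<exists>y. c.chain (Suc (Suc i)) y \<and> (\<forall>b<crk (Suc i). x b = c.d (Suc i) y b)"
    proof (intro exI[of _ ?y] conjI allI impI)
      show "c.chain (Suc (Suc i)) ?y"
        using u v by (simp add: chain_iff) (simp add: chain_def polys_in_uminus)
      fix b assume "b < crk (Suc i)"
      then have "b < rk (Suc i) + rk i" by (simp add: crk_simps)
      then show "x b = c.d (Suc i) ?y b"
      proof (cases rule: less_add_cases)
        case 1
        have "d (Suc i) ?y b = d (Suc i) v b" by (intro d_cong) simp
        then show ?thesis using v(2)[OF 1] 1 by (simp add: d_top algebra_simps)
      next
        case (2 b')
        then show ?thesis using u(2)[OF 2(2)] by (simp add: d_bot d_uminus)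
      qed
    qed
  next
    fix p :: "('v, 'k) mpoly" assume p: "p \<in> polys_in V"
    have ins: "(\<lambda>A. A \<inter> insert w W \<noteq> {}) = (\<lambda>A. A \<inter> W \<noteq> {} \<or> {w} \<subseteq> A)"
      by (auto simp: fun_eq_iff)
    show "p \<in> mideal V (\<lambda>A. A \<inter> insert w W \<noteq> {}) \<longleftrightarrow> (\<exists>y. c.chain (Suc 0) y \<and> p = c.d 0 y 0)"
    proof
      assume "p \<in> mideal V (\<lambda>A. A \<inter> insert w W \<noteq> {})"
      then obtain q s where q: "p = q + ?w * s" "q \<in> mideal V (\<lambda>A. A \<inter> W \<noteq> {})" "s \<in> polys_in V"
        unfolding ins by (rule sqf_division[rotated]) auto
      then obtain y where y: "chain (Suc 0) y" "q = d 0 y 0"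
        using image[of q] mideal_subset by blast
      let ?y = "\<lambda>b. if b < rk (Suc 0) then y b else s"
      have "c.chain (Suc 0) ?y"
        using y(1) q(3) by (simp add: chain_iff) (simp add: chain_def)
      moreover have "d 0 ?y 0 = d 0 y 0" by (intro d_cong) simp
      then have "p = c.d 0 ?y 0" using q(1) y(2) rk0 by (simp add: d_top)
      ultimately show "\<exists>y. c.chain (Suc 0) y \<and> p = c.d 0 y 0" by blast
    next
      assume "\<exists>y. c.chain (Suc 0) y \<and> p = c.d 0 y 0"
      then obtain y where y: "chain (Suc 0) y" "chain 0 (\<lambda>b. y (rk (Suc 0) + b))"
        "p = d 0 y 0 + ?w * y (rk (Suc 0) + 0)"
        using rk0 by (auto simp: chain_iff d_top)
      have s: "y (rk (Suc 0) + 0) \<in> polys_in V" using y(2) rk0 by (simp add: chain_def)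
      have "d 0 y 0 \<in> polys_in V" using polys_in_diff[OF p polys_in_mult[OF hcomp_subset[OF w_mem] s]] y(3) by simp
      then have "d 0 y 0 \<in> mideal V (\<lambda>A. A \<inter> W \<noteq> {})" using image y(1) by blast
      then have "d 0 y 0 \<in> mideal V (\<lambda>A. A \<inter> insert w W \<noteq> {})" by (rule mideal_mono[rotated]) auto
      moreover have "?w * y (rk (Suc 0) + 0) \<in> mideal V (\<lambda>A. A \<inter> insert w W \<noteq> {})"
        by (rule iffD2[OF sqf_times_mem_iff]) (use s w in \<open>auto simp: mideal_def\<close>)
      ultimately show "p \<in> mideal V (\<lambda>A. A \<inter> insert w W \<noteq> {})"
        unfolding y(3) by (rule mideal_add)
    qed
  qed
qed

end

lemma koszul_complex_exists:
  fixes V :: "'v set"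
  assumes "finite W" "W \<subseteq> V"
  shows "\<exists>rk sh. \<exists>D :: nat \<Rightarrow> nat \<Rightarrow> nat \<Rightarrow> ('v, 'k::field) mpoly. koszul_complex V rk sh D W"
  using assms
proof (induction W rule: finite_induct)
  case empty
  then show ?case using koszul_complex_empty by blast
next
  case (insert w W)
  then obtain rk sh and D :: "nat \<Rightarrow> nat \<Rightarrow> nat \<Rightarrow> ('v, 'k) mpoly" where K: "koszul_complex V rk sh D W" by auto
  have "w \<in> V" "w \<notin> W" using insert by auto
  from koszul_complex.koszul_complex_insert[OF K this] show ?case by (intro exI)
qed

text \<open>For \<open>W = V\<close> the resolved ideal consists of the polynomials without constant
  term, which is the kernel of the map to \<open>K\<close>.\<close>

lemma field_resolution_exists:
  fixes V :: "'v set"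
  assumes "finite V"
  shows "\<exists>rk sh. \<exists>D :: nat \<Rightarrow> nat \<Rightarrow> nat \<Rightarrow> ('v, 'k::field) mpoly. \<exists>aug. field_resolution V rk sh D aug"
proof -
  obtain rk sh and D :: "nat \<Rightarrow> nat \<Rightarrow> nat \<Rightarrow> ('v, 'k) mpoly" where "koszul_complex V rk sh D V"
    using koszul_complex_exists[OF assms order_refl] by blast
  then interpret k: koszul_complex V rk sh D V .
  have "p \<in> mideal V (\<lambda>A. A \<inter> V \<noteq> {}) \<longleftrightarrow> Poly_Mapping.lookup p 0 = 0"
    if p: "p \<in> polys_in V" for p :: "('v, 'k) mpoly"
  proof -
    have "Poly_Mapping.keys m \<inter> V \<noteq> {} \<longleftrightarrow> m \<noteq> 0" if "m \<in> Poly_Mapping.keys p" for m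
      using p that by (auto simp: polys_in_def simp flip: keys_eq_empty)
    then show ?thesis using p by (auto simp: mideal_def in_keys_iff)
  qed
  note const = this
  have "field_resolution V rk sh D (\<lambda>_. 1)"
  proof
    show "(\<Sum>b<rk 0. Poly_Mapping.lookup (x b) 0 * 1) = 0 \<longleftrightarrow>
      (\<exists>y. k.chain (Suc 0) y \<and> (\<forall>b<rk 0. x b = k.d 0 y b))" if "k.chain 0 x" for x
      using that k.rk0 const[of "x 0"] k.image[of "x 0"] by (simp add: k.chain_def)
    show "\<exists>x. k.chain 0 x \<and> (\<Sum>b<rk 0. Poly_Mapping.lookup (x b) 0 * 1) = 1"
      using k.rk0 by (intro exI[of _ "\<lambda>_. 1"]) (simp add: k.chain_def)
    show "sh 0 b = 0" if "b < rk 0" for b using that k.rk0 k.sh0 by simp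
    show "D i c b \<in> hcomp V (sh (Suc i) b - sh i c)" if "c < rk i" "b < rk (Suc i)" for i c b
      using that by (rule k.homog)
    show "k.d i (k.d (Suc i) x) c = 0" if "k.chain (Suc (Suc i)) x" "c < rk i" for i x c
      using that by (rule k.dd)
    show "\<exists>y. k.chain (Suc (Suc i)) y \<and> (\<forall>b<rk (Suc i). x b = k.d (Suc i) y b)"
      if "k.chain (Suc i) x" "\<And>c. c < rk i \<Longrightarrow> k.d i x c = 0" for i x
      using that by (rule k.exact)
  qed
  then show ?thesis by blast
qed

section \<open>Quotients of modules and dimension\<close>

lemma quot_module_simps:
  "carrier (quot_module M H) = (\<lambda>x. H +>\<^bsub>M\<^esub> x) ` carrier M"
  "add (quot_module M H) = set_add M"
  "zero (quot_module M H) = H"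
  "smult (quot_module M H) = (\<lambda>r X. \<Union>x\<in>X. H +>\<^bsub>M\<^esub> (r \<odot>\<^bsub>M\<^esub> x))"
  by (auto simp: quot_module_def FactRing_def ring.defs module.defs A_RCOSETS_def' a_r_coset_def')

locale quotient_by_submodule = Module.module R M + Module.submodule H R M for R :: "('r, 'z) ring_scheme" and M :: "('r, 'm, 'y) module_scheme" (structure) and H
begin

lemma sub: "abelian_subgroup H M"
  using subgroup_axioms by (intro abelian_subgroupI3 additive_subgroupI) unfold_locales

lemma coset_eq_iff:
  assumes "x \<in> carrier M" "y \<in> carrier M"
  shows "H +> x = H +> y \<longleftrightarrow> x \<ominus> y \<in> H"
proof
  assume "H +> x = H +> y"
  then have "x \<in> H +> y" using abelian_subgroup.a_rcos_self[OF sub assms(1)] by simp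
  then show "x \<ominus> y \<in> H"
    using abelian_subgroup.a_rcos_module[OF sub assms(2,1)] by (simp add: a_minus_def)
next
  assume "x \<ominus> y \<in> H"
  then have "x \<in> H +> y"
    using abelian_subgroup.a_rcos_module[OF sub assms(2,1)] by (simp add: a_minus_def)
  then show "H +> x = H +> y"
    using a_repr_independence[of x H y] assms subgroup_axioms by simp
qed

lemma coset_add:
  "x \<in> carrier M \<Longrightarrow> y \<in> carrier M \<Longrightarrow>
    (H +> x) \<oplus>\<^bsub>quot_module M H\<^esub> (H +> y) = H +> (x \<oplus> y)"
  by (simp add: quot_module_simps abelian_subgroup.a_rcos_sum[OF sub])

lemma coset_zero: "\<zero>\<^bsub>quot_module M H\<^esub> = H +> \<zero>"
  using abelian_subgroup.a_rcos_const[OF sub] subgroup.one_closed[OF subgroup_axioms]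
  by (simp add: quot_module_simps)

lemma coset_smult:
  assumes "r \<in> carrier R" "x \<in> carrier M"
  shows "r \<odot>\<^bsub>quot_module M H\<^esub> (H +> x) = H +> (r \<odot> x)"
proof -
  have eq: "H +> (r \<odot> y) = H +> (r \<odot> x)" if y: "y \<in> H +> x" for y
  proof -
    have yc: "y \<in> carrier M"
      using y assms(2) a_r_coset_subset_G[of H x] subgroup.subset[OF subgroup_axioms] by auto
    have "y \<ominus> x \<in> H"
      using abelian_subgroup.a_rcos_module[OF sub assms(2) yc] y by (simp add: a_minus_def)
    then have "r \<odot> (y \<ominus> x) \<in> H" using assms(1) by (rule smult_closed[rotated])
    moreover have "r \<odot> (y \<ominus> x) = (r \<odot> y) \<ominus> (r \<odot> x)"
      using assms yc by (simp add: a_minus_def smult_r_distr smult_r_minus)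
    ultimately have "(r \<odot> y) \<ominus> (r \<odot> x) \<in> H" by simp
    moreover have "r \<odot> y \<in> carrier M" "r \<odot> x \<in> carrier M"
      using assms yc by (auto intro: module.smult_closed[OF module_axioms])
    ultimately show ?thesis using coset_eq_iff by blast
  qed
  have "(\<Union>y\<in>H +> x. H +> (r \<odot> y)) = H +> (r \<odot> x)"
  proof (rule SUP_eq_const)
    show "H +> x \<noteq> {}" using abelian_subgroup.a_rcos_self[OF sub assms(2)] by blast
  qed (rule eq)
  then show ?thesis by (simp only: quot_module_simps)
qed

end

text \<open>The vector space laws of the record \<open>T\<close> are transported along
  \<open>\<phi>\<close> from a subspace \<open>Z\<close> of a type-class vector space. This is used
  both for the cycles and for their quotient by the boundaries, where \<open>\<phi>\<close> passes
  to cosets.\<close>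

locale image_space = vector_space scale
  for scale :: "'k::field \<Rightarrow> 'a::ab_group_add \<Rightarrow> 'a" +
  fixes Z :: "'a set" and \<phi> :: "'a \<Rightarrow> 'm" and T :: "('k, 'm, 'z) module_scheme"
  assumes Z0: "0 \<in> Z" and Z_add: "f \<in> Z \<Longrightarrow> g \<in> Z \<Longrightarrow> f + g \<in> Z"
    and Z_scale: "f \<in> Z \<Longrightarrow> scale c f \<in> Z"
    and carrier_T: "carrier T = \<phi> ` Z"
    and zero_T: "\<zero>\<^bsub>T\<^esub> = \<phi> 0"
    and add_T: "f \<in> Z \<Longrightarrow> g \<in> Z \<Longrightarrow> \<phi> f \<oplus>\<^bsub>T\<^esub> \<phi> g = \<phi> (f + g)"
    and smult_T: "f \<in> Z \<Longrightarrow> c \<odot>\<^bsub>T\<^esub> \<phi> f = \<phi> (scale c f)"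
begin

lemma Z_uminus: "f \<in> Z \<Longrightarrow> - f \<in> Z"
  using Z_scale[of f "- 1"] by simp

lemma vectorspace_T: "vectorspace class_ring T"
proof -
  have "abelian_group T"
  proof (rule abelian_groupI)
    show "\<exists>y\<in>carrier T. y \<oplus>\<^bsub>T\<^esub> x = \<zero>\<^bsub>T\<^esub>" if x: "x \<in> carrier T" for x
    proof -
      obtain f where f: "f \<in> Z" "x = \<phi> f" using x carrier_T by auto
      then have "\<phi> (- f) \<oplus>\<^bsub>T\<^esub> x = \<zero>\<^bsub>T\<^esub>" using Z_uminus by (simp add: add_T zero_T)
      then show ?thesis using f carrier_T Z_uminus by blast
    qed
  qed (auto simp: carrier_T zero_T add_T Z0 Z_add add_ac)
  then have "Module.module class_ring T"
  proof (intro moduleI)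
    show "cring (class_ring :: 'k ring)" by (rule class_cring.is_cring)
  qed (auto simp: carrier_T zero_T add_T smult_T Z0 Z_add Z_scale scale_left_distrib scale_right_distrib)
  then show ?thesis by (simp add: vectorspace_def class_field)
qed

lemma uminus_T: "f \<in> Z \<Longrightarrow> \<ominus>\<^bsub>T\<^esub> \<phi> f = \<phi> (- f)"
proof -
  assume f: "f \<in> Z"
  interpret T: vectorspace class_ring T by (rule vectorspace_T)
  show ?thesis
    by (rule T.M.minus_equality) (use f in \<open>simp_all add: carrier_T zero_T add_T Z_uminus\<close>)
qed

text \<open>\<open>dim\<close> is the least size of a finite generating set, which is informative
  only if one exists; the finite set \<open>S\<close> supplies it. Dimension 0 then means that the
  empty set generates.\<close>

lemma dim_eq_0_iff:
  assumes "finite S" "Z \<subseteq> span S"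
  shows "vectorspace.dim class_ring T = 0 \<longleftrightarrow> (\<forall>f\<in>Z. \<phi> f = \<phi> 0)"
proof -
  interpret T: vectorspace class_ring T by (rule vectorspace_T)
  \<comment> \<open>\<open>S\<close> may leave \<open>Z\<close>, where \<open>\<phi>\<close> is not
    controlled, so a basis inside \<open>Z\<close> is taken; independence bounds its size by that of
    \<open>S\<close>.\<close>
  obtain B where B: "B \<subseteq> Z" "independent B" "Z \<subseteq> span B"
    using maximal_independent_subset by blast
  have fin: "finite B" using independent_span_bound[OF assms(1) B(2)] B(1) assms(2) by blast
  have sub: "\<phi> ` B \<subseteq> carrier T" using B(1) carrier_T by auto
  have submod: "LinearCombinations.submodule class_ring (T.span (\<phi> ` B)) T" by (rule T.span_is_submodule[OF sub])
  have own: "\<phi> ` B \<subseteq> T.span (\<phi> ` B)" by (rule T.in_own_span[OF sub])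
  have "f \<in> Z \<and> \<phi> f \<in> T.span (\<phi> ` B)" if "f \<in> span B" for f
    using that
  proof (induction rule: span_induct_alt)
    case base
    have "\<zero>\<^bsub>T\<^esub> \<in> T.span (\<phi> ` B)"
      using submod by (simp add: LinearCombinations.submodule_def)
    then show ?case using Z0 by (simp add: zero_T)
  next
    case (step c x y)
    then have x: "x \<in> Z" "\<phi> x \<in> T.span (\<phi> ` B)" using B(1) own by auto
    have "c \<odot>\<^bsub>T\<^esub> \<phi> x \<oplus>\<^bsub>T\<^esub> \<phi> y \<in> T.span (\<phi> ` B)"
      using submod x step by (simp add: LinearCombinations.submodule_def)
    then show ?case using x step by (simp add: Z_add Z_scale smult_T add_T)
  qed
  then have "carrier T \<subseteq> T.span (\<phi> ` B)" using B(3) by (auto simp: carrier_T)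
  then have gen: "T.span (\<phi> ` B) = carrier T"
    using submod by (auto simp: LinearCombinations.submodule_def)
  have empty: "T.span {} = {\<zero>\<^bsub>T\<^esub>}" by (auto simp: T.span_def T.lincomb_def)
  let ?Q = "\<lambda>n. \<exists>A. finite A \<and> card A = n \<and> A \<subseteq> carrier T \<and> T.span A = carrier T"
  have ex: "?Q (card (\<phi> ` B))" using gen fin sub by blast
  have "T.dim = 0 \<longleftrightarrow> ?Q 0"
  proof
    assume "T.dim = 0"
    then show "?Q 0" using LeastI[of ?Q, OF ex] unfolding T.dim_def by (simp only:)
  next
    assume "?Q 0"
    then show "T.dim = 0" unfolding T.dim_def by (rule Least_eq_0)
  qed
  also have "\<dots> \<longleftrightarrow> carrier T = {\<zero>\<^bsub>T\<^esub>}"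
    using empty by auto
  also have "\<dots> \<longleftrightarrow> (\<forall>f\<in>Z. \<phi> f = \<phi> 0)"
    using Z0 by (auto simp: carrier_T zero_T)
  finally show ?thesis .
qed

end

section \<open>Betti numbers in terms of lifted chains\<close>

lemma poly_ring_simps [simp]:
  "carrier (poly_ring V) = polys_in V" "mult (poly_ring V) = (*)" "one (poly_ring V) = 1"
  "zero (poly_ring V) = 0" "add (poly_ring V) = (+)" "smult (poly_ring V) = (*)"
  "grade (poly_ring V) j = hcomp V j"
  by (auto simp: poly_ring_def hcomp_def)

lemma residue_field_simps [simp]:
  "carrier residue_field = UNIV" "mult residue_field = (*)" "one residue_field = 1"
  "zero residue_field = 0" "add residue_field = (+)"
  "smult residue_field = (\<lambda>p c. Poly_Mapping.lookup p 0 * c)"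
  "grade residue_field j = (if j = 0 then UNIV else {0})"
  by (simp_all add: residue_field_def)

lemma cring_poly_ring: "cring (poly_ring V)"
proof (intro cringI abelian_groupI comm_monoidI)
  show "\<exists>y\<in>carrier (poly_ring V). y \<oplus>\<^bsub>poly_ring V\<^esub> x = \<zero>\<^bsub>poly_ring V\<^esub>"
    if "x \<in> carrier (poly_ring V)" for x
    using that by (intro bexI[of _ "- x"]) (auto simp: polys_in_uminus)
qed (auto simp: polys_in_add polys_in_mult algebra_simps)

lemma abelian_group_poly_ring: "abelian_group (poly_ring V)"
  using cring_poly_ring cring.axioms(1) ring.is_abelian_group by blast

lemma module_poly_ring: "Module.module (poly_ring V) (poly_ring V)"
  by (intro moduleI cring_poly_ring abelian_group_poly_ring) (auto simp: polys_in_add polys_in_mult algebra_simps)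

lemma a_inv_poly_ring: "p \<in> polys_in V \<Longrightarrow> \<ominus>\<^bsub>poly_ring V\<^esub> p = - p"
proof -
  assume p: "p \<in> polys_in V"
  interpret abelian_group "poly_ring V" by (rule abelian_group_poly_ring)
  show ?thesis by (rule minus_equality) (use p in \<open>auto simp: polys_in_uminus\<close>)
qed

lemma finsum_poly_ring:
  assumes "finite A" "\<And>b. b \<in> A \<Longrightarrow> f b \<in> polys_in V"
  shows "finsum (poly_ring V) f A = sum f A"
proof -
  interpret abelian_group "poly_ring V" by (rule abelian_group_poly_ring)
  show ?thesis using assms
  proof (induction A rule: finite_induct)
    case (insert x A)
    then show ?case using finsum_insert[of A x f] by (auto simp: Pi_def)
  qed simp
qed

lemma finsum_residue_field:
  "finite A \<Longrightarrow> finsum (residue_field :: (('v, 'k::field) mpoly, 'k) graded_module) f A = sum f A"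
proof -
  let ?K = "residue_field :: (('v, 'k) mpoly, 'k) graded_module"
  interpret K: abelian_group ?K
  proof (rule abelian_groupI)
    show "\<exists>y\<in>carrier ?K. y \<oplus>\<^bsub>?K\<^esub> x = \<zero>\<^bsub>?K\<^esub>" for x
      by (intro bexI[of _ "- x"]) auto
  qed (auto simp: add_ac)
  assume "finite A"
  then show ?thesis
    by (induction A rule: finite_induct) auto
qed

lemma lookup_mconst_times: "Poly_Mapping.lookup (mconst c * p) m = c * Poly_Mapping.lookup p m"
  unfolding mconst_def mult_map_scale_conv_mult[symmetric]
  by (simp add: Poly_Mapping.map.rep_eq when_def)

lemma mconst_mem [simp]: "mconst c \<in> hcomp V 0" "mconst c \<in> polys_in V"
  by (auto simp: mconst_def hcomp_def polys_in_def)

lemma mconst_1: "mconst 1 = 1"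
  and mconst_add: "mconst (a + b) = mconst a + mconst b" and mconst_mult: "mconst (a * b) = mconst a * mconst b"
  by (simp_all add: mconst_def single_add mult_single)

text \<open>Equalities of sets of extensional functions are tested on restrictions of chains, which
  turns them into the elementwise axioms of the locale.\<close>

lemma graded_free_resolution_iff:
  fixes F :: "(('v, 'k::field) mpoly, 'k) free_complex"
  shows "graded_free_resolution (poly_ring V) residue_field F \<longleftrightarrow>
    field_resolution V (rank_at F) (shift F) (diff_mat F) (aug_gen F)"
proof -
  interpret free_cplx V "rank_at F" "shift F" "diff_mat F" .
  let ?rk = "rank_at F" and ?S = "poly_ring V :: (('v, 'k) mpoly, ('v, 'k) mpoly) graded_module"
    and ?K = "residue_field :: (('v, 'k) mpoly, 'k) graded_module"
  let ?hom = "\<forall>i. \<forall>c<?rk i. \<forall>b<?rk (Suc i). diff_mat F i c b \<in> hcomp V (shift F (Suc i) b - shift F i c)"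
  let ?im = "\<lambda>i x. \<exists>y. chain (Suc i) y \<and> (\<forall>b<?rk i. x b = d i y b)"
  let ?\<epsilon> = "\<lambda>x. \<Sum>b<?rk 0. Poly_Mapping.lookup (x b) 0 * aug_gen F b"
  let ?res = "\<lambda>i x. restrict x {..<?rk i}"
  have TC: "x \<in> tensor_carrier F ?S i \<longleftrightarrow> chain i x \<and> x = ?res i x" for i x
    by (auto simp: tensor_carrier_def chain_def PiE_iff extensional_restrict) (metis restrict_extensional)
  have chain_res: "chain i (?res i x) \<longleftrightarrow> chain i x" for i x by (simp add: chain_def)
  have res_eq: "?res i x = ?res i y \<longleftrightarrow> (\<forall>b<?rk i. x b = y b)" for i x y
    by (auto simp: fun_eq_iff restrict_def)
  have aug: "augmentation F ?K x = ?\<epsilon> x" for x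
    by (simp add: augmentation_def finsum_residue_field)
  have eps_res: "?\<epsilon> (?res 0 x) = ?\<epsilon> x" for x by (intro sum.cong) auto
  have set_eq: "A = B \<longleftrightarrow> (\<forall>x. chain i x \<longrightarrow> (?res i x \<in> A \<longleftrightarrow> ?res i x \<in> B))"
    if "A \<subseteq> tensor_carrier F ?S i" "B \<subseteq> tensor_carrier F ?S i" for A B i
    using that TC by (metis subset_antisym subsetD subsetI)
  have surj: "augmentation F ?K ` tensor_carrier F ?S 0 = carrier ?K \<longleftrightarrow> (\<exists>x. chain 0 x \<and> ?\<epsilon> x = 1)"
  proof
    assume *: "augmentation F ?K ` tensor_carrier F ?S 0 = carrier ?K"
    then have "1 \<in> augmentation F ?K ` tensor_carrier F ?S 0" by simp
    then show "\<exists>x. chain 0 x \<and> ?\<epsilon> x = 1" using TC aug by force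
  next
    assume "\<exists>x. chain 0 x \<and> ?\<epsilon> x = 1"
    then obtain x where x: "chain 0 x" "?\<epsilon> x = 1" by blast
    have "c \<in> augmentation F ?K ` tensor_carrier F ?S 0" for c
    proof
      show "?res 0 (\<lambda>b. mconst c * x b) \<in> tensor_carrier F ?S 0"
        using x(1) by (simp add: TC chain_res) (simp add: chain_def polys_in_mult)
      have "?\<epsilon> (\<lambda>b. mconst c * x b) = c * ?\<epsilon> x"
        by (simp add: lookup_mconst_times sum_distrib_left mult.assoc)
      then show "c = augmentation F ?K (?res 0 (\<lambda>b. mconst c * x b))"
        using x(2) eps_res by (simp add: aug)
    qed
    then show "augmentation F ?K ` tensor_carrier F ?S 0 = carrier ?K" by auto
  qed
  have ah: "(\<forall>b<?rk 0. aug_gen F b \<in> grade ?K (shift F 0 b)) \<longleftrightarrow>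
    (\<forall>b<?rk 0. aug_gen F b \<noteq> 0 \<longrightarrow> shift F 0 b = 0)" by auto
  \<comment> \<open>Both sides contain homogeneity of the matrices. Granting it, the entries lie in
    the polynomial ring, so that \<open>finsum\<close> is an ordinary sum.\<close>
  show ?thesis
  proof (cases ?hom)
    case False
    then show ?thesis by (auto simp: graded_free_resolution_def field_resolution_def)
  next
    case hom: True
    then have D: "c < ?rk i \<Longrightarrow> b < ?rk (Suc i) \<Longrightarrow> diff_mat F i c b \<in> polys_in V" for i c b
      using hcomp_subset by blast
    have td: "tensor_diff F ?S i x = ?res i (d i x)" if "chain (Suc i) x" for i x
    proof -
      have "finsum ?S (\<lambda>b. diff_mat F i c b * x b) {..<?rk (Suc i)} = d i x c" if "c < ?rk i" for c
        unfolding d_def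
        by (rule finsum_poly_ring) (use that \<open>chain (Suc i) x\<close> D in \<open>auto simp: chain_def polys_in_mult\<close>)
      then show ?thesis by (auto simp: tensor_diff_def fun_eq_iff)
    qed
    have d_chain: "chain i (d i x)" if "chain (Suc i) x" for i x
      using that D unfolding chain_def d_def by (auto intro!: polys_in_sum polys_in_mult)
    have d_res: "d i (?res (Suc i) x) = d i x" for i x
      by (rule ext, rule d_cong) simp
    have image: "?res i x \<in> tensor_diff F ?S i ` tensor_carrier F ?S (Suc i) \<longleftrightarrow> ?im i x" for i x
    proof
      assume "?res i x \<in> tensor_diff F ?S i ` tensor_carrier F ?S (Suc i)"
      then obtain y where "chain (Suc i) y" "?res i x = ?res i (d i y)" using TC td by auto
      then show "?im i x" unfolding res_eq by blast
    next
      assume "?im i x"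
      then obtain y where y: "chain (Suc i) y" "?res i x = ?res i (d i y)" unfolding res_eq by blast
      then have "?res i x = tensor_diff F ?S i (?res (Suc i) y)" by (simp add: td chain_res d_res)
      then show "?res i x \<in> tensor_diff F ?S i ` tensor_carrier F ?S (Suc i)"
        using y(1) TC chain_res by (metis imageI restrict_restrict Int_absorb)
    qed
    have image_sub: "tensor_diff F ?S i ` tensor_carrier F ?S (Suc i) \<subseteq> tensor_carrier F ?S i" for i
      using TC td d_chain chain_res by (auto simp: restrict_restrict)
    have ker: "?res (Suc i) x \<in> {x \<in> tensor_carrier F ?S (Suc i). tensor_diff F ?S i x = tensor_zero F ?S i}
      \<longleftrightarrow> (\<forall>c<?rk i. d i x c = 0)" if "chain (Suc i) x" for i x
      using that by (auto simp: TC chain_res td d_res tensor_zero_def res_eq)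
    have E: "{x \<in> tensor_carrier F ?S (Suc i). tensor_diff F ?S i x = tensor_zero F ?S i} =
        tensor_diff F ?S (Suc i) ` tensor_carrier F ?S (Suc (Suc i)) \<longleftrightarrow>
      (\<forall>x. chain (Suc i) x \<longrightarrow> ((\<forall>c<?rk i. d i x c = 0) \<longleftrightarrow> ?im (Suc i) x))" for i
      by (subst set_eq[OF _ image_sub]) (use ker image in auto)
    have E0: "{x \<in> tensor_carrier F ?S 0. augmentation F ?K x = \<zero>\<^bsub>?K\<^esub>} =
        tensor_diff F ?S 0 ` tensor_carrier F ?S (Suc 0) \<longleftrightarrow>
      (\<forall>x. chain 0 x \<longrightarrow> (?\<epsilon> x = 0 \<longleftrightarrow> ?im 0 x))"
      by (subst set_eq[OF _ image_sub]) (use image in \<open>auto simp: aug eps_res TC chain_res restrict_restrict\<close>)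
    \<comment> \<open>Equality of kernel and image contains both the complex property and exactness,
      which the locale lists separately.\<close>
    have dde: "(\<forall>i x. chain (Suc i) x \<longrightarrow> ((\<forall>c<?rk i. d i x c = 0) \<longleftrightarrow> ?im (Suc i) x)) \<longleftrightarrow>
      (\<forall>i x c. chain (Suc (Suc i)) x \<longrightarrow> c < ?rk i \<longrightarrow> d i (d (Suc i) x) c = 0) \<and>
      (\<forall>i x. chain (Suc i) x \<longrightarrow> (\<forall>c<?rk i. d i x c = 0) \<longrightarrow> ?im (Suc i) x)"
      (is "?A \<longleftrightarrow> ?B \<and> ?C")
    proof (intro iffI conjI)
      assume A: ?A
      show ?B
      proof (intro allI impI)
        fix i x c assume x: "chain (Suc (Suc i)) x" "c < ?rk i"
        then have "?im (Suc i) (d (Suc i) x)" by blast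
        then show "d i (d (Suc i) x) c = 0" using A d_chain[OF x(1)] x(2) by blast
      qed
      show ?C using A by blast
    next
      assume BC: "?B \<and> ?C"
      have "d i x c = 0" if "?im (Suc i) x" "c < ?rk i" for i x c
      proof -
        obtain y where y: "chain (Suc (Suc i)) y" "\<And>b. b < ?rk (Suc i) \<Longrightarrow> x b = d (Suc i) y b"
          using \<open>?im (Suc i) x\<close> by blast
        have "d i x c = d i (d (Suc i) y) c" using y(2) by (rule d_cong)
        then show ?thesis using BC y(1) \<open>c < ?rk i\<close> by simp
      qed
      then show ?A using BC by blast
    qed
    show ?thesis
      unfolding graded_free_resolution_def field_resolution_def surj E E0 ah poly_ring_simps
      using hom dde by meson
  qed
qed

section \<open>Edge ideals described by supports\<close>

text \<open>The nonfaces of the independence complex of the graph.\<close>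

definition edge_pred :: "'v set set \<Rightarrow> 'v set \<Rightarrow> bool" where
  "edge_pred E A \<longleftrightarrow> (\<exists>e\<in>E. e \<subseteq> A)"

lemma mono_edge_pred: "mono (edge_pred E)"
  by (intro monoI) (auto simp: edge_pred_def)

lemma subgroup_mideal: "subgroup (mideal V P) (add_monoid (poly_ring V))"
proof
  show "inv\<^bsub>add_monoid (poly_ring V)\<^esub> x \<in> mideal V P" if "x \<in> mideal V P" for x
    using that a_inv_poly_ring[OF mideal_subset[OF that]] by (simp add: a_inv_def mideal_uminus)
qed (auto simp: mideal_subset mideal_add)

lemma mideal_mult_right: "mono P \<Longrightarrow> q \<in> mideal V P \<Longrightarrow> p \<in> polys_in V \<Longrightarrow> q * p \<in> mideal V P"
  using mideal_mult[of P p V q] by (simp add: mult.commute)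

lemma ideal_mideal: "mono P \<Longrightarrow> ideal (mideal V P) (poly_ring V)"
  by (intro idealI cring.axioms(1) cring_poly_ring subgroup_mideal) (auto simp: mideal_mult mideal_mult_right)

text \<open>One inclusion is minimality of the generated ideal. For the other, the generators are
  split off one edge at a time by \<open>sqf_division\<close>; as there are no loops, every
  generator is squarefree.\<close>

lemma edge_ideal_eq:
  assumes "fin_simple_graph V E"
  shows "(edge_ideal V E :: ('v, 'k::field) mpoly set) = mideal V (edge_pred E)"
proof
  let ?G = "{mvar x * mvar y | x y. {x, y} \<in> E} :: ('v, 'k) mpoly set"
  interpret ring "poly_ring V :: (('v, 'k) mpoly, ('v, 'k) mpoly) graded_module"
    by (intro cring.axioms(1) cring_poly_ring)
  have E: "finite E" "\<And>e. e \<in> E \<Longrightarrow> finite e \<and> e \<subseteq> V"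
    using assms finite_subset[of E "Pow V"] by (auto simp: fin_simple_graph_def intro: finite_subset)
  have gen: "mvar x * mvar y = (sqf {x, y} :: ('v, 'k) mpoly)" if "{x, y} \<in> E" for x y
  proof -
    have "x \<noteq> y" using that assms by (auto simp: fin_simple_graph_def)
    then show ?thesis by (simp add: mvar_def sqf_def ones_def mult_single)
  qed
  have sqf: "sqf e \<in> mideal V (edge_pred E)" if "e \<in> E" for e
    using sqf_times_mem_iff[of e V 1 "edge_pred E"] E(2)[OF that] that
    by (auto simp: mideal_def edge_pred_def)
  have "?G \<subseteq> mideal V (edge_pred E)" using gen sqf by auto
  then show "edge_ideal V E \<subseteq> (mideal V (edge_pred E) :: ('v, 'k) mpoly set)"
    unfolding edge_ideal_def by (intro genideal_minimal ideal_mideal mono_edge_pred)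
  have "?G \<subseteq> polys_in V" using \<open>?G \<subseteq> mideal V (edge_pred E)\<close> mideal_subset by blast
  then have G: "?G \<subseteq> carrier (poly_ring V)" by simp
  interpret I: ideal "edge_ideal V E :: ('v, 'k) mpoly set" "poly_ring V"
    unfolding edge_ideal_def by (rule genideal_ideal[OF G])
  have "p \<in> edge_ideal V E" if "finite E'" "E' \<subseteq> E" "p \<in> mideal V (edge_pred E')" for E' and p :: "('v, 'k) mpoly"
    using that
  proof (induction E' arbitrary: p rule: finite_induct)
    case empty
    then have "p = 0" by (auto simp: mideal_def edge_pred_def simp flip: keys_eq_empty)
    then show ?case using I.zero_closed by simp
  next
    case (insert e E')
    have "(\<lambda>A. edge_pred (insert e E') A) = (\<lambda>A. edge_pred E' A \<or> e \<subseteq> A)"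
      by (auto simp: edge_pred_def fun_eq_iff)
    then have "p \<in> mideal V (\<lambda>A. edge_pred E' A \<or> e \<subseteq> A)" using insert.prems by simp
    then obtain q s where q: "p = q + sqf e * s" "q \<in> mideal V (edge_pred E')" "s \<in> polys_in V"
      using insert.prems E(2)[of e] by (elim sqf_division[rotated]) auto
    obtain x y where e: "e = {x, y}"
      using insert.prems assms by (auto simp: fin_simple_graph_def card_2_iff)
    have "{x, y} \<in> E" using insert.prems e by simp
    moreover from this have "sqf e = (mvar x * mvar y :: ('v, 'k) mpoly)" using gen[of x y] e by simp
    ultimately have "sqf e \<in> ?G" by blast
    then have "(sqf e :: ('v, 'k) mpoly) \<in> edge_ideal V E" unfolding edge_ideal_def by (rule subsetD[OF genideal_self[OF G]])
    then have "sqf e * s \<in> edge_ideal V E" using I.I_r_closed q(3) by simp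
    then show ?case using I.a_closed[of q "sqf e * s"] insert.IH[of q] insert.prems q by simp
  qed
  then show "mideal V (edge_pred E) \<subseteq> (edge_ideal V E :: ('v, 'k) mpoly set)" using E(1) by blast
qed

lemma graded_quot_simps [simp]:
  "carrier (graded_quot M H) = (\<lambda>x. H +>\<^bsub>M\<^esub> x) ` carrier M"
  "add (graded_quot M H) = add (quot_module M H)" "zero (graded_quot M H) = zero (quot_module M H)"
  "smult (graded_quot M H) = smult (quot_module M H)"
  "grade (graded_quot M H) j = (\<lambda>x. H +>\<^bsub>M\<^esub> x) ` grade M j"
  by (simp_all add: graded_quot_def module.defs graded_module.defs quot_module_simps)

lemma sum_fun_apply: "(\<Sum>a\<in>A. f a) x = (\<Sum>a\<in>A. f a x)"
  by (induction A rule: infinite_finite_induct) auto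

lemma finite_monomials:
  assumes "finite V"
  shows "finite {m :: 'v \<Rightarrow>\<^sub>0 nat. Poly_Mapping.keys m \<subseteq> V \<and> int (mon_degree m) = j}"
proof -
  let ?A = "{m :: 'v \<Rightarrow>\<^sub>0 nat. Poly_Mapping.keys m \<subseteq> V \<and> int (mon_degree m) = j}"
  have "Poly_Mapping.lookup ` ?A \<subseteq> {f. \<forall>x. (x \<in> V \<longrightarrow> f x \<in> {..nat j}) \<and> (x \<notin> V \<longrightarrow> f x = 0)}"
  proof clarify
    fix m :: "'v \<Rightarrow>\<^sub>0 nat" and x
    assume m: "Poly_Mapping.keys m \<subseteq> V" "j = int (mon_degree m)"
    have "Poly_Mapping.lookup m x \<le> mon_degree m"
      unfolding mon_degree_def
      using member_le_sum[of x "Poly_Mapping.keys m" "Poly_Mapping.lookup m"]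
      by (cases "x \<in> Poly_Mapping.keys m") (simp_all add: in_keys_iff)
    then show "(x \<in> V \<longrightarrow> Poly_Mapping.lookup m x \<in> {..nat (int (mon_degree m))}) \<and>
      (x \<notin> V \<longrightarrow> Poly_Mapping.lookup m x = 0)"
      using m(1) by (auto simp: in_keys_iff)
  qed
  moreover have "finite {f. \<forall>x. (x \<in> V \<longrightarrow> f x \<in> {..nat j}) \<and> (x \<notin> V \<longrightarrow> f x = 0)}"
    using assms by (intro finite_set_of_finite_funs) auto
  ultimately have "finite (Poly_Mapping.lookup ` ?A)" by (rule finite_subset)
  moreover have "inj_on Poly_Mapping.lookup ?A" by (intro inj_onI) (rule poly_mapping_eq_iff[THEN iffD2])
  ultimately show ?thesis by (rule finite_imageD)
qed

section \<open>Homology of the tensor product as a vector space\<close>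

locale tor_complex =
  field_resolution V "rank_at F" "shift F" "diff_mat F" "aug_gen F"
  for V :: "'v set" and F :: "(('v, 'k::field) mpoly, 'k) free_complex" +
  fixes P :: "'v set \<Rightarrow> bool"
  assumes fin: "finite V" and mono: "mono P"
begin

abbreviation "S \<equiv> poly_ring V :: (('v, 'k) mpoly, ('v, 'k) mpoly) graded_module"
abbreviation "I \<equiv> mideal V P :: ('v, 'k) mpoly set"
abbreviation "N \<equiv> graded_quot S I"
abbreviation "cls p \<equiv> I +>\<^bsub>S\<^esub> p"

sublocale Q: quotient_by_submodule S S I
proof (intro quotient_by_submodule.intro module_poly_ring)
  show "Module.submodule I S S"
    by (intro Module.submodule.intro subgroup_mideal) (auto simp: Module.submodule_axioms_def mideal_mult mono)
qed

lemma cls_eq_iff: "p \<in> polys_in V \<Longrightarrow> q \<in> polys_in V \<Longrightarrow> cls p = cls q \<longleftrightarrow> p - q \<in> I"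
  using Q.coset_eq_iff[of p q] by (simp add: a_minus_def a_inv_poly_ring)

lemma cls_add: "p \<in> polys_in V \<Longrightarrow> q \<in> polys_in V \<Longrightarrow> cls p \<oplus>\<^bsub>N\<^esub> cls q = cls (p + q)"
  using Q.coset_add[of p q] by simp

lemma cls_smult: "r \<in> polys_in V \<Longrightarrow> p \<in> polys_in V \<Longrightarrow> r \<odot>\<^bsub>N\<^esub> cls p = cls (r * p)"
  using Q.coset_smult[of r p] by simp

lemma cls_zero: "\<zero>\<^bsub>N\<^esub> = cls 0"
  using Q.coset_zero by simp

lemma finsum_cls:
  assumes "finite A" "\<And>b. b \<in> A \<Longrightarrow> f b \<in> polys_in V"
  shows "finsum N (\<lambda>b. cls (f b)) A = cls (sum f A)"
proof -
  interpret N: abelian_monoid N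
    by (rule abelian_monoidI) (auto simp: cls_add cls_zero polys_in_add add_ac simp del: graded_quot_simps(2,3))
  show ?thesis using assms
  proof (induction A rule: finite_induct)
    case empty
    then show ?case using cls_zero by (simp del: graded_quot_simps)
  next
    case (insert x A)
    have "finsum N (\<lambda>b. cls (f b)) (insert x A) = cls (f x) \<oplus>\<^bsub>N\<^esub> finsum N (\<lambda>b. cls (f b)) A"
      using insert by (intro N.finsum_insert) auto
    then show ?case using insert by (simp add: cls_add polys_in_sum del: graded_quot_simps)
  qed
qed

definition lift :: "nat \<Rightarrow> (nat \<Rightarrow> ('v, 'k) mpoly) \<Rightarrow> nat \<Rightarrow> ('v, 'k) mpoly set" where
  "lift i f = (\<lambda>b\<in>{..<rank_at F i}. cls (f b))"

lemma lift_eq_iff: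
  "chain i f \<Longrightarrow> chain i g \<Longrightarrow> lift i f = lift i g \<longleftrightarrow> ichain P i (\<lambda>b. f b - g b)"
  by (auto simp: lift_def fun_eq_iff restrict_def ichain_def chain_def cls_eq_iff)

lemma tensor_zero_eq: "tensor_zero F N i = lift i 0"
  by (simp add: tensor_zero_def lift_def cls_zero del: graded_quot_simps)

lemma tensor_diff_lift:
  assumes "chain (Suc i) f"
  shows "tensor_diff F N i (lift (Suc i) f) = lift i (d i f)"
proof -
  have "finsum N (\<lambda>b. diff_mat F i c b \<odot>\<^bsub>N\<^esub> lift (Suc i) f b) {..<rank_at F (Suc i)} = cls (d i f c)"
    if c: "c < rank_at F i" for c
  proof -
    have f: "diff_mat F i c b \<in> polys_in V" "f b \<in> polys_in V" if "b < rank_at F (Suc i)" for b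
      using that assms D_polys[OF c that] by (auto simp: chain_def)
    interpret N: abelian_monoid N
      by (rule abelian_monoidI) (auto simp: cls_add cls_zero polys_in_add add_ac simp del: graded_quot_simps(2,3))
    have "finsum N (\<lambda>b. diff_mat F i c b \<odot>\<^bsub>N\<^esub> lift (Suc i) f b) {..<rank_at F (Suc i)} =
        finsum N (\<lambda>b. cls (diff_mat F i c b * f b)) {..<rank_at F (Suc i)}"
      by (rule N.finsum_cong') (auto simp: lift_def cls_smult f polys_in_mult simp del: graded_quot_simps(2-))
    then show ?thesis using finsum_cls[of "{..<rank_at F (Suc i)}" "\<lambda>b. diff_mat F i c b * f b"] f
      by (simp add: d_def polys_in_mult)
  qed
  then show ?thesis by (auto simp: tensor_diff_def lift_def fun_eq_iff restrict_def)
qed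

lemma tensor_comp_eq: "tensor_comp F N i j = lift i ` {f. hchain i j f \<and> (\<forall>b\<ge>rank_at F i. f b = 0)}"
proof (intro equalityI subsetI)
  fix x assume x: "x \<in> tensor_comp F N i j"
  then have "\<forall>b<rank_at F i. \<exists>p\<in>hcomp V (j - shift F i b). x b = cls p"
    by (auto simp: tensor_comp_def PiE_iff)
  then obtain f where f: "\<And>b. b < rank_at F i \<Longrightarrow> f b \<in> hcomp V (j - shift F i b) \<and> x b = cls (f b)" by metis
  let ?f = "\<lambda>b. if b < rank_at F i then f b else 0"
  have "x = lift i ?f"
  proof
    fix b show "x b = lift i ?f b"
      using f x by (cases "b < rank_at F i") (auto simp: lift_def tensor_comp_def PiE_iff extensional_def)
  qed
  then show "x \<in> lift i ` {f. hchain i j f \<and> (\<forall>b\<ge>rank_at F i. f b = 0)}"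
    using f by (auto simp: hchain_def)
qed (auto simp: tensor_comp_def lift_def hchain_def)

text \<open>Lifted cycles are normalised to 0 beyond the rank. Their unconstrained tails would
  otherwise make the space infinite-dimensional, and \<open>dim_eq_0_iff\<close> needs a finite
  spanning set.\<close>

definition Z :: "nat \<Rightarrow> int \<Rightarrow> (nat \<Rightarrow> ('v, 'k) mpoly) set" where
  "Z i j = {f. cyc P i j f \<and> (\<forall>b\<ge>rank_at F i. f b = 0)}"

definition scl :: "'k \<Rightarrow> (nat \<Rightarrow> ('v, 'k) mpoly) \<Rightarrow> nat \<Rightarrow> ('v, 'k) mpoly" where
  "scl c f = (\<lambda>b. mconst c * f b)"

lemma vector_space_scl: "vector_space scl"
  by unfold_locales (auto simp: scl_def fun_eq_iff mconst_add mconst_mult mconst_1 algebra_simps)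

lemma Z_hchain: "f \<in> Z i j \<Longrightarrow> hchain i j f"
  by (simp add: Z_def cyc_def)

lemma Z_chain: "f \<in> Z i j \<Longrightarrow> chain i f"
  using Z_hchain hchain_chain by blast

lemma carrier_cycles: "carrier (tor_cycles F N i j) = lift i ` Z i j"
proof (cases i)
  case 0
  then show ?thesis using tensor_comp_eq[of 0 j]
    by (simp add: tor_cycles_def Z_def cyc_def del: graded_quot_simps)
next
  case (Suc k)
  have "tensor_diff F N k (lift i f) = tensor_zero F N k \<longleftrightarrow> ichain P k (d k f)" if "hchain i j f" for f
  proof -
    have "chain (Suc k) f" using that Suc hchain_chain by blast
    moreover have "chain k (0 :: nat \<Rightarrow> ('v, 'k) mpoly)" by (simp add: chain_def)
    ultimately show ?thesis
      using Suc lift_eq_iff[OF d_chain, of k f 0]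
      by (simp add: tensor_diff_lift tensor_zero_eq)
  qed
  then show ?thesis using tensor_comp_eq[of i j] Suc
    by (auto simp: tor_cycles_def Z_def cyc_def simp del: graded_quot_simps)
qed

lemma image_space_cycles: "image_space scl (Z i j) (lift i) (tor_cycles F N i j)"
proof (intro image_space.intro vector_space_scl image_space_axioms.intro carrier_cycles)
  show "0 \<in> Z i j"
    by (auto simp: Z_def cyc_def hchain_def ichain_def d_def split: nat.split)
  show "f + g \<in> Z i j" if "f \<in> Z i j" "g \<in> Z i j" for f g
  proof -
    have *: "f + g = (\<lambda>b. f b + g b)" by (simp add: fun_eq_iff)
    show ?thesis using that hchain_add unfolding *
      by (auto simp: Z_def cyc_def ichain_def d_add mideal_add split: nat.splits)
  qed
  show "scl c f \<in> Z i j" if "f \<in> Z i j" for c f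
  proof -
    have "hchain i j (scl c f)"
      unfolding hchain_def scl_def
    proof (intro allI impI)
      fix b assume "b < rank_at F i"
      then have "mconst c * f b \<in> hcomp V (0 + (j - shift F i b))"
        using that by (intro hcomp_mult mconst_mem) (auto simp: Z_def cyc_def hchain_def)
      then show "mconst c * f b \<in> hcomp V (j - shift F i b)" by simp
    qed
    then show ?thesis using that
      by (auto simp: Z_def cyc_def ichain_def scl_def d_mult mideal_mult mono split: nat.splits)
  qed
  show "\<zero>\<^bsub>tor_cycles F N i j\<^esub> = lift i 0"
    by (simp add: tor_cycles_def tensor_zero_eq del: graded_quot_simps)
  show "lift i f \<oplus>\<^bsub>tor_cycles F N i j\<^esub> lift i g = lift i (f + g)" if "f \<in> Z i j" "g \<in> Z i j" for f g
    using Z_chain[OF that(1)] Z_chain[OF that(2)]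
    by (auto simp: tor_cycles_def lift_def chain_def cls_add fun_eq_iff restrict_def simp del: graded_quot_simps)
  show "c \<odot>\<^bsub>tor_cycles F N i j\<^esub> lift i f = lift i (scl c f)" if "f \<in> Z i j" for c f
    using Z_chain[OF that]
    by (auto simp: tor_cycles_def lift_def chain_def cls_smult scl_def fun_eq_iff restrict_def simp del: graded_quot_simps)
qed

text \<open>A homogeneous chain is a combination of monomials placed in single coordinates, and
  there are finitely many monomials of each degree in the finite set \<open>V\<close>.\<close>

lemma Z_finite_span: "\<exists>B. finite B \<and> Z i j \<subseteq> module.span scl B"
proof -
  interpret vs: vector_space scl by (rule vector_space_scl)
  let ?M = "\<lambda>b. {m. Poly_Mapping.keys m \<subseteq> V \<and> int (mon_degree m) = j - shift F i b}"
  let ?u = "\<lambda>b m. \<lambda>b'. if b' = b then Poly_Mapping.single m 1 else (0 :: ('v, 'k) mpoly)"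
  let ?B = "\<Union>b<rank_at F i. ?u b ` ?M b"
  have "finite ?B" using finite_monomials[OF fin] by auto
  moreover have "f \<in> vs.span ?B" if f: "f \<in> Z i j" for f
  proof -
    have hc: "f b \<in> hcomp V (j - shift F i b)" if "b < rank_at F i" for b
      using Z_hchain[OF f] that by (simp add: hchain_def)
    have "f = (\<Sum>b<rank_at F i. \<Sum>m\<in>Poly_Mapping.keys (f b). scl (Poly_Mapping.lookup (f b) m) (?u b m))"
    proof
      fix b'
      have "(\<Sum>b<rank_at F i. \<Sum>m\<in>Poly_Mapping.keys (f b). scl (Poly_Mapping.lookup (f b) m) (?u b m)) b' =
        (\<Sum>b<rank_at F i. if b = b' then f b' else 0)"
        unfolding sum_fun_apply
      proof (rule sum.cong)
        fix b
        have "(\<Sum>m\<in>Poly_Mapping.keys (f b). scl (Poly_Mapping.lookup (f b) m) (?u b m) b) = f b"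
          by (simp add: scl_def mconst_def mult_single flip: poly_mapping_expand)
        then show "(\<Sum>m\<in>Poly_Mapping.keys (f b). scl (Poly_Mapping.lookup (f b) m) (?u b m) b') = (if b = b' then f b' else 0)"
          by (auto simp: scl_def)
      qed simp
      also have "\<dots> = f b'" using f by (auto simp: Z_def)
      finally show "f b' = (\<Sum>b<rank_at F i. \<Sum>m\<in>Poly_Mapping.keys (f b). scl (Poly_Mapping.lookup (f b) m) (?u b m)) b'" ..
    qed
    also have "\<dots> \<in> vs.span ?B"
    proof (intro vs.span_sum vs.span_scale vs.span_base)
      fix b m assume b: "b \<in> {..<rank_at F i}" and "m \<in> Poly_Mapping.keys (f b)"
      then have "m \<in> ?M b" using hc[of b] by (auto simp: hcomp_def polys_in_def)
      then show "?u b m \<in> ?B" using b by blast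
    qed
    finally show ?thesis .
  qed
  ultimately show ?thesis by blast
qed

lemma boundaries_eq: "tor_boundaries F N i j = lift i ` {d i y | y. hchain (Suc i) j y}"
proof -
  have "lift (Suc i) ` {f. hchain (Suc i) j f \<and> (\<forall>b\<ge>rank_at F (Suc i). f b = 0)} = lift (Suc i) ` {f. hchain (Suc i) j f}"
  proof (intro equalityI subsetI)
    fix x assume "x \<in> lift (Suc i) ` {f. hchain (Suc i) j f}"
    then obtain f where f: "x = lift (Suc i) f" "hchain (Suc i) j f" by auto
    let ?f = "\<lambda>b. if b < rank_at F (Suc i) then f b else 0"
    have "x = lift (Suc i) ?f" using f(1) by (auto simp: lift_def fun_eq_iff restrict_def)
    moreover have "hchain (Suc i) j ?f" using f(2) by (simp add: hchain_def)
    ultimately show "x \<in> lift (Suc i) ` {f. hchain (Suc i) j f \<and> (\<forall>b\<ge>rank_at F (Suc i). f b = 0)}" by auto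
  qed auto
  then have "tor_boundaries F N i j = tensor_diff F N i ` lift (Suc i) ` {f. hchain (Suc i) j f}"
    by (simp add: tor_boundaries_def tensor_comp_eq del: graded_quot_simps)
  also have "\<dots> = lift i ` {d i y | y. hchain (Suc i) j y}"
    using tensor_diff_lift[OF hchain_chain] by (force simp del: graded_quot_simps)
  finally show ?thesis .
qed

lemma boundary_iff:
  assumes "f \<in> Z i j"
  shows "lift i f \<in> tor_boundaries F N i j \<longleftrightarrow> bdry P i j f"
proof -
  have "lift i f = lift i (d i y) \<longleftrightarrow> ichain P i (\<lambda>b. f b - d i y b)" if "hchain (Suc i) j y" for y
    using lift_eq_iff[OF Z_chain[OF assms] d_chain] that hchain_chain by blast
  then show ?thesis unfolding boundaries_eq bdry_def by auto
qed

lemma bdry_closed: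
  "bdry P i j 0"
  "bdry P i j f \<Longrightarrow> bdry P i j g \<Longrightarrow> bdry P i j (f + g)"
  "bdry P i j f \<Longrightarrow> bdry P i j (scl c f)"
proof -
  show "bdry P i j 0"
    unfolding bdry_def by (intro exI[of _ "\<lambda>_. 0"]) (simp add: hchain_def ichain_def d_def)
  show "bdry P i j (f + g)" if f: "bdry P i j f" and g: "bdry P i j g"
  proof -
    obtain y z where "hchain (Suc i) j y" "ichain P i (\<lambda>b. f b - d i y b)"
      "hchain (Suc i) j z" "ichain P i (\<lambda>b. g b - d i z b)"
      using f g by (auto simp: bdry_def)
    then show ?thesis
      by (intro bdryI[of i j "\<lambda>b. y b + z b" P "\<lambda>b. (f b - d i y b) + (g b - d i z b)"] hchain_add ichain_add)
        (auto simp: d_add)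
  qed
  show "bdry P i j (scl c f)" if f: "bdry P i j f"
  proof -
    obtain y where y: "hchain (Suc i) j y" "ichain P i (\<lambda>b. f b - d i y b)"
      using f by (auto simp: bdry_def)
    have "hchain (Suc i) j (\<lambda>b. mconst c * y b)"
      using y(1) hcomp_mult[OF mconst_mem(1)] by (force simp: hchain_def)
    moreover have "ichain P i (\<lambda>b. mconst c * (f b - d i y b))"
      using y(2) by (simp add: ichain_def mideal_mult mono)
    ultimately show ?thesis
      by (rule bdryI) (simp add: d_mult scl_def algebra_simps)
  qed
qed

text \<open>\<open>lift\<close> followed by the coset map exhibits homology as an image of the
  lifted cycles; a class vanishes exactly if its lift is a boundary modulo the ideal.\<close>

lemma dim_homology_eq_0_iff:
  "vectorspace.dim class_ring (quot_module (tor_cycles F N i j) (tor_boundaries F N i j)) = 0 \<longleftrightarrow> van P i j"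
proof -
  let ?T = "tor_cycles F N i j" and ?B = "tor_boundaries F N i j"
  interpret T: image_space scl "Z i j" "lift i" ?T by (rule image_space_cycles)
  interpret vT: vectorspace class_ring ?T by (rule T.vectorspace_T)
  have mem: "x \<in> ?B \<longleftrightarrow> (\<exists>f\<in>Z i j. x = lift i f \<and> bdry P i j f)" for x
  proof
    assume "x \<in> ?B"
    then obtain y where y: "x = lift i (d i y)" "hchain (Suc i) j y" by (auto simp: boundaries_eq)
    let ?f = "\<lambda>b. if b < rank_at F i then d i y b else 0"
    have x: "x = lift i ?f" using y(1) by (auto simp: lift_def fun_eq_iff restrict_def)
    moreover have "?f \<in> Z i j"
    proof -
      have "hchain i j ?f" using d_hchain[OF y(2)] by (simp add: hchain_def)
      moreover have "ichain P k (d k ?f)" if "i = Suc k" for k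
      proof -
        have "d k ?f c = 0" if "c < rank_at F k" for c
          using dd[OF hchain_chain[OF y(2)[unfolded \<open>i = Suc k\<close>]] that] \<open>i = Suc k\<close>
            d_cong[of k ?f "d i y" c] by simp
        then show ?thesis by (simp add: ichain_def)
      qed
      ultimately show ?thesis by (auto simp: Z_def cyc_def split: nat.split)
    qed
    ultimately show "\<exists>f\<in>Z i j. x = lift i f \<and> bdry P i j f" using boundary_iff \<open>x \<in> ?B\<close> by blast
  qed (use boundary_iff in auto)
  have sub: "Module.submodule ?B class_ring ?T"
  proof (rule vT.module.submoduleI)
    show "?B \<subseteq> carrier ?T" using mem carrier_cycles by auto
    show "\<zero>\<^bsub>?T\<^esub> \<in> ?B" unfolding mem using T.zero_T T.Z0 bdry_closed(1) by blast
    show "\<ominus>\<^bsub>?T\<^esub> a \<in> ?B" if a: "a \<in> ?B" for a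
    proof -
      obtain f where f: "f \<in> Z i j" "a = lift i f" "bdry P i j f" using a mem by blast
      have "- f = scl (- 1) f" by simp
      then show ?thesis unfolding mem using T.uminus_T f T.Z_uminus bdry_closed(3) by metis
    qed
    show "a \<oplus>\<^bsub>?T\<^esub> b \<in> ?B" if a: "a \<in> ?B" and b: "b \<in> ?B" for a b
      using a b unfolding mem using T.add_T T.Z_add bdry_closed(2) by metis
    show "c \<odot>\<^bsub>?T\<^esub> a \<in> ?B" if "c \<in> carrier class_ring" and a: "a \<in> ?B" for c a
      using a unfolding mem using T.smult_T T.Z_scale bdry_closed(3) by metis
  qed
  interpret QT: quotient_by_submodule class_ring ?T ?B
    by (intro quotient_by_submodule.intro sub vT.module.module_axioms)
  let ?\<psi> = "\<lambda>f. ?B +>\<^bsub>?T\<^esub> lift i f"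
  have carr: "lift i f \<in> carrier ?T" if "f \<in> Z i j" for f using that carrier_cycles by blast
  interpret H: image_space scl "Z i j" ?\<psi> "quot_module ?T ?B"
  proof (intro image_space.intro vector_space_scl image_space_axioms.intro)
    show "carrier (quot_module ?T ?B) = ?\<psi> ` Z i j"
      by (auto simp: quot_module_simps carrier_cycles)
    show "\<zero>\<^bsub>quot_module ?T ?B\<^esub> = ?\<psi> 0" using QT.coset_zero T.zero_T by simp
    show "?\<psi> f \<oplus>\<^bsub>quot_module ?T ?B\<^esub> ?\<psi> g = ?\<psi> (f + g)" if "f \<in> Z i j" "g \<in> Z i j" for f g
      using that by (simp add: QT.coset_add carr T.add_T)
    show "c \<odot>\<^bsub>quot_module ?T ?B\<^esub> ?\<psi> f = ?\<psi> (scl c f)" if "f \<in> Z i j" for c f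
      using that by (simp add: QT.coset_smult carr T.smult_T)
  qed (fact T.Z0 T.Z_add T.Z_scale)+
  obtain B where B: "finite B" "Z i j \<subseteq> module.span scl B" using Z_finite_span by blast
  have "?\<psi> f = ?\<psi> 0 \<longleftrightarrow> bdry P i j f" if f: "f \<in> Z i j" for f
  proof -
    have "?\<psi> f = ?\<psi> 0 \<longleftrightarrow> lift i f \<ominus>\<^bsub>?T\<^esub> lift i 0 \<in> ?B"
      by (rule QT.coset_eq_iff) (use f carr T.Z0 in auto)
    also have "lift i f \<ominus>\<^bsub>?T\<^esub> lift i 0 = lift i f"
      using f T.Z0 by (simp add: a_minus_def T.uminus_T T.add_T)
    finally show ?thesis unfolding boundary_iff[OF f] .
  qed
  then have "vectorspace.dim class_ring (quot_module ?T ?B) = 0 \<longleftrightarrow> (\<forall>f\<in>Z i j. bdry P i j f)"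
    using H.dim_eq_0_iff[OF B] by simp
  also have "\<dots> \<longleftrightarrow> van P i j"
  proof
    assume *: "\<forall>f\<in>Z i j. bdry P i j f"
    show "van P i j" unfolding van_def
    proof (intro allI impI)
      fix x assume x: "cyc P i j x"
      \<comment> \<open>Cutting off the tail moves \<open>x\<close> into \<open>Z\<close>, and
        neither \<open>cyc\<close> nor \<open>bdry\<close> notices the difference.\<close>
      let ?x = "\<lambda>b. if b < rank_at F i then x b else 0"
      have "cyc P i j ?x"
      proof (cases i)
        case (Suc k)
        have "d k ?x c = d k x c" for c using Suc by (intro d_cong) simp
        then show ?thesis using x Suc by (simp add: cyc_def hchain_def ichain_def)
      qed (use x in \<open>simp add: cyc_def hchain_def\<close>)
      then have "bdry P i j ?x" using * by (simp add: Z_def)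
      then show "bdry P i j x" by (simp add: bdry_def ichain_def)
    qed
  qed (auto simp: van_def Z_def)
  finally show ?thesis .
qed

end

text \<open>The hypothesis ranges over all resolutions because \<open>Tor\<close> selects an
  unspecified one. Vanishing outside strands 0 to \<open>r\<close> makes the set under
  \<open>Max\<close> finite, and the corner shows that \<open>r\<close> belongs to it.\<close>

lemma regularity_eqI:
  fixes V :: "'v set" and E :: "'v set set" and r :: nat
  assumes G: "fin_simple_graph V E"
    and corner: "\<And>rk sh (D :: nat \<Rightarrow> nat \<Rightarrow> nat \<Rightarrow> ('v, 'k::field) mpoly) aug. field_resolution V rk sh D aug \<Longrightarrow>
      \<exists>p. field_resolution.corner V rk sh D (edge_pred E) r p"
  shows "regularity V (edge_ring V E :: (('v, 'k) mpoly, _) graded_module) = int r"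
proof -
  let ?S = "poly_ring V :: (('v, 'k) mpoly, ('v, 'k) mpoly) graded_module"
    and ?K = "residue_field :: (('v, 'k) mpoly, 'k) graded_module"
  let ?N = "edge_ring V E :: (('v, 'k) mpoly, _) graded_module"
  have fin: "finite V" using G by (simp add: fin_simple_graph_def)
  define F where "F = (SOME F. graded_free_resolution ?S ?K F)"
  obtain rk sh and D :: "nat \<Rightarrow> nat \<Rightarrow> nat \<Rightarrow> ('v, 'k) mpoly" and aug where "field_resolution V rk sh D aug"
    using field_resolution_exists[OF fin] by blast
  then have "graded_free_resolution ?S ?K \<lparr>rank_at = rk, shift = sh, diff_mat = D, aug_gen = aug\<rparr>"
    by (simp add: graded_free_resolution_iff)
  then have "graded_free_resolution ?S ?K F" unfolding F_def by (rule someI)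
  then have R: "field_resolution V (rank_at F) (shift F) (diff_mat F) (aug_gen F)"
    by (simp add: graded_free_resolution_iff)
  interpret tor_complex V F "edge_pred E"
    by (intro tor_complex.intro R tor_complex_axioms.intro fin mono_edge_pred)
  obtain p where c: "corner (edge_pred E) r p" using corner[OF R] by blast
  have betti: "betti V ?N i j \<noteq> 0 \<longleftrightarrow> \<not> van (edge_pred E) i j" for i j
    unfolding betti_def Tor_def Let_def F_def[symmetric] edge_ring_def edge_ideal_eq[OF G]
    by (simp only: dim_homology_eq_0_iff)
  let ?R = "{j - int i | i j. betti V ?N i j \<noteq> 0}"
  have sub: "?R \<subseteq> {0..int r}"
  proof
    fix x assume "x \<in> ?R"
    then obtain i j where x: "x = j - int i" "\<not> van (edge_pred E) i j" unfolding betti by blast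
    then have "\<not> j < int i" "\<not> j > int i + int r" using corner_below[OF c] corner_above[OF c] by blast+
    then show "x \<in> {0..int r}" using x(1) by simp
  qed
  have "Max ?R = int r"
  proof (rule Max_eqI)
    show "finite ?R" by (rule finite_subset[OF sub]) simp
    show "y \<le> int r" if "y \<in> ?R" for y using subsetD[OF sub that] by simp
    have "int r = (int p + int r) - int p" by simp
    then show "int r \<in> ?R" using corner_at[OF c] unfolding betti by blast
  qed
  then show ?thesis by (simp add: regularity_def)
qed

section \<open>Five-cycles and a clique under a common apex\<close>

definition five_cycle :: "nat \<Rightarrow> nat set set" where
  "five_cycle k = {{5*k, 5*k+1}, {5*k+1, 5*k+2}, {5*k+2, 5*k+3}, {5*k+3, 5*k+4}, {5*k+4, 5*k}}"

definition clique_vertices :: "nat \<Rightarrow> nat \<Rightarrow> nat set" where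
  "clique_vertices a b = {5*a+1..5*a+2*b+2}"

text \<open>Numbers below \<open>5*a\<close> form the five-cycles in groups of five,
  \<open>5*a\<close> is the apex, and the numbers above it are the clique.\<close>

definition cone_vertices :: "nat \<Rightarrow> nat \<Rightarrow> nat set" where
  "cone_vertices a b = {..5*a+2*b+2}"

definition cone_edges :: "nat \<Rightarrow> nat \<Rightarrow> nat set set" where
  "cone_edges a b = (\<Union>k<a. five_cycle k) \<union>
     {{x, y} | x y. x \<in> clique_vertices a b \<and> y \<in> clique_vertices a b \<and> x \<noteq> y} \<union>
     {{5*a, v} | v. v \<in> cone_vertices a b \<and> v \<noteq> 5*a}"

text \<open>The vertices other than the apex \<open>5 a\<close> fall into blocks: block \<open>k < a\<close> is a five-cycle,
  block \<open>a\<close> is the clique.\<close>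

definition block :: "nat \<Rightarrow> nat \<Rightarrow> nat" where
  "block a v = min a (v div 5)"

lemma cone_edge_cases:
  assumes "e \<in> cone_edges a b"
  obtains k where "k < a" "e \<in> five_cycle k"
  | x y where "e = {x, y}" "x \<in> clique_vertices a b" "y \<in> clique_vertices a b" "x \<noteq> y"
  | v where "e = {5*a, v}" "v \<in> cone_vertices a b" "v \<noteq> 5*a"
  using assms by (auto simp: cone_edges_def)

lemma five_cycle_vertex: "e \<in> five_cycle k \<Longrightarrow> x \<in> e \<Longrightarrow> 5*k \<le> x \<and> x \<le> 5*k+4"
  by (auto simp: five_cycle_def)

lemma five_cycle_edge: "k < a \<Longrightarrow> e \<in> five_cycle k \<Longrightarrow> e \<in> cone_edges a b"
  by (auto simp: cone_edges_def)

lemma clique_edge: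
  "x \<in> clique_vertices a b \<Longrightarrow> y \<in> clique_vertices a b \<Longrightarrow> x \<noteq> y \<Longrightarrow> {x, y} \<in> cone_edges a b"
  by (auto simp: cone_edges_def)

lemma apex_edge: "v \<in> cone_vertices a b \<Longrightarrow> v \<noteq> 5*a \<Longrightarrow> {5*a, v} \<in> cone_edges a b"
  by (auto simp: cone_edges_def)

lemma block_five_cycle: "k < a \<Longrightarrow> e \<in> five_cycle k \<Longrightarrow> x \<in> e \<Longrightarrow> block a x = k \<and> x < 5*a"
  using five_cycle_vertex[of e k x] by (auto simp: block_def min_def)

lemma block_clique: "x \<in> clique_vertices a b \<Longrightarrow> block a x = a \<and> x \<noteq> 5*a"
  by (auto simp: clique_vertices_def block_def min_def)

text \<open>Away from the apex no edge connects two blocks. This gives 3-disjointness across blocks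
  and lets matching edges be counted block by block.\<close>

lemma edge_block:
  assumes "e \<in> cone_edges a b" "x \<in> e" "y \<in> e" "x \<noteq> 5*a" "y \<noteq> 5*a"
  shows "block a x = block a y"
  using assms(1)
proof (cases rule: cone_edge_cases)
  case (1 k)
  then show ?thesis using block_five_cycle assms by metis
next
  case (2 u v)
  then show ?thesis using block_clique assms(2,3) by auto
qed (use assms in auto)

lemma fin_simple_cone: "fin_simple_graph (cone_vertices a b) (cone_edges a b)"
  unfolding fin_simple_graph_def
proof (intro conjI ballI)
  fix e assume "e \<in> cone_edges a b"
  then show "e \<subseteq> cone_vertices a b"
  proof (cases rule: cone_edge_cases)
    case (1 k)
    then show ?thesis using five_cycle_vertex[of e k] by (fastforce simp: cone_vertices_def)
  qed (auto simp: cone_vertices_def clique_vertices_def)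
next
  fix e assume "e \<in> cone_edges a b"
  then show "card e = 2"
    by (cases rule: cone_edge_cases) (auto simp: five_cycle_def)
qed (simp add: cone_vertices_def)

lemma cone_edge_subset: "e \<in> cone_edges a b \<Longrightarrow> e \<subseteq> cone_vertices a b"
  and card_cone_edge: "e \<in> cone_edges a b \<Longrightarrow> card e = 2"
  using fin_simple_cone[of a b] by (auto simp: fin_simple_graph_def)

lemma finite_cone_edges: "finite (cone_edges a b)"
  using fin_simple_cone[of a b] finite_subset[of "cone_edges a b" "Pow (cone_vertices a b)"]
  by (auto simp: fin_simple_graph_def)

lemma connected_cone: "connected_graph (cone_vertices a b) (cone_edges a b)"
proof -
  let ?R = "{(x, y). {x, y} \<in> cone_edges a b}"
  have *: "(5*a, v) \<in> ?R\<^sup>*" "(v, 5*a) \<in> ?R\<^sup>*" if "v \<in> cone_vertices a b" for v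
    using apex_edge[OF that] by (cases "v = 5*a"; force simp: insert_commute)+
  then show ?thesis
    unfolding connected_graph_def using rtrancl_trans[OF *(2) *(1)] by (auto simp: cone_vertices_def)
qed

section \<open>Regularity of the cone\<close>

lemma regularity_cone:
  "regularity (cone_vertices a b) (edge_ring (cone_vertices a b) (cone_edges a b) ::
     ((nat, 'k::field) mpoly, _) graded_module) = int (2*a + 1)"
proof (rule regularity_eqI[OF fin_simple_cone])
  fix rk sh and D :: "nat \<Rightarrow> nat \<Rightarrow> nat \<Rightarrow> (nat, 'k) mpoly" and aug
  let ?V = "cone_vertices a b" and ?K = "clique_vertices a b"
  assume "field_resolution ?V rk sh D aug"
  then interpret field_resolution ?V rk sh D aug .
  let ?P = "\<lambda>k. edge_pred (\<Union>i<k. five_cycle i)"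
  have ind: "?P k (insert x A) = ?P k A" if x: "5*k \<le> x" for k x A
  proof -
    have "x \<notin> e" if "i < k" "e \<in> five_cycle i" for i e
      using five_cycle_vertex[OF that(2), of x] that(1) x by auto
    then show ?thesis by (auto simp: edge_pred_def subset_insert)
  qed
  have cycles: "corner (?P k) (2*k) (3*k)" if "k \<le> a" for k
    using that
  proof (induction k)
    case 0
    have "?P 0 = (\<lambda>_. False)" by (auto simp: edge_pred_def fun_eq_iff)
    then show ?case using corner_zero by simp
  next
    case (Suc k)
    have "corner (\<lambda>A. ?P k A \<or> {5*k, 5*k+1} \<subseteq> A \<or> {5*k+1, 5*k+2} \<subseteq> A \<or> {5*k+2, 5*k+3} \<subseteq> A \<or>
        {5*k+3, 5*k+4} \<subseteq> A \<or> {5*k+4, 5*k} \<subseteq> A) (2*k + 2) (3*k + 3)"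
      using Suc by (intro corner_five_cycle) (auto simp: cone_vertices_def ind)
    moreover have "(\<lambda>A. ?P k A \<or> {5*k, 5*k+1} \<subseteq> A \<or> {5*k+1, 5*k+2} \<subseteq> A \<or> {5*k+2, 5*k+3} \<subseteq> A \<or>
        {5*k+3, 5*k+4} \<subseteq> A \<or> {5*k+4, 5*k} \<subseteq> A) = ?P (Suc k)"
      by (simp add: edge_pred_def fun_eq_iff lessThan_Suc five_cycle_def disj_ac bex_Un)
    ultimately show ?case by (simp add: algebra_simps)
  qed
  let ?Q = "\<lambda>A. ?P a A \<or> (\<exists>x\<in>?K. \<exists>y\<in>?K. x \<noteq> y \<and> {x, y} \<subseteq> A)"
  let ?N = "?V - {5*a}"
  have "corner ?Q (Suc (2*a)) (3*a + card ?K - 1)"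
    by (rule corner_clique[OF cycles[OF order_refl]]) (auto simp: clique_vertices_def cone_vertices_def ind)
  then have Q: "corner ?Q (Suc (2*a)) (3*a + 2*b + 1)" by (simp add: clique_vertices_def)
  \<comment> \<open>Every edge of the graph without apex meets \<open>?N\<close>, so the colon ideal
    of the apex is generated by the variables in \<open>?N\<close> alone.\<close>
  have meets: "A \<inter> ?N \<noteq> {}" if "?Q A" for A
  proof -
    have "\<exists>e. e \<subseteq> A \<and> e \<noteq> {} \<and> e \<subseteq> ?N"
      using that
    proof
      assume "?P a A"
      then obtain i e where e: "i < a" "e \<in> five_cycle i" "e \<subseteq> A" by (auto simp: edge_pred_def)
      then have "e \<subseteq> ?N" using block_five_cycle[OF e(1,2)] cone_edge_subset[OF five_cycle_edge[OF e(1,2)]] by blast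
      moreover have "e \<noteq> {}" using card_cone_edge[OF five_cycle_edge[OF e(1,2)]] by auto
      ultimately show ?thesis using e(3) by blast
    next
      assume "\<exists>x\<in>?K. \<exists>y\<in>?K. x \<noteq> y \<and> {x, y} \<subseteq> A"
      then obtain x where "x \<in> ?K" "x \<in> A" by blast
      then show ?thesis by (intro exI[of _ "{x}"]) (auto simp: clique_vertices_def cone_vertices_def)
    qed
    then show ?thesis by blast
  qed
  have "corner (\<lambda>A. False \<or> A \<inter> ?N \<noteq> {}) 0 (0 + card ?N)"
    by (intro corner_vars corner_zero) (auto simp: cone_vertices_def)
  moreover have "(\<lambda>A. False \<or> A \<inter> ?N \<noteq> {}) = (\<lambda>A. ?Q A \<or> A \<inter> ?N \<noteq> {})"
    using meets by (auto simp: fun_eq_iff)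
  moreover have "card ?N = 5*a + 2*b + 2" by (simp add: cone_vertices_def)
  ultimately have N: "corner (\<lambda>A. ?Q A \<or> A \<inter> ?N \<noteq> {}) 0 (5*a + 2*b + 2)" by simp
  have ind_Q: "?Q (insert (5*a) A) = ?Q A" for A
    by (auto simp: ind clique_vertices_def)
  have "corner (\<lambda>A. ?Q A \<or> 5*a \<in> A \<and> A \<inter> ?N \<noteq> {}) (Suc (2*a)) (Suc (3*a + 2*b + 1))"
  proof (rule corner_vertex_right[OF N Q _ _ ind_Q])
    \<comment> \<open>For \<open>a = 0\<close> both outer terms reach the top strand and end in the
      same degree \<open>2*b + 2\<close>; for positive \<open>a\<close> the colon term stays below
      that strand.\<close>
    show "Suc 0 < Suc (2*a) \<or> 5*a + 2*b + 2 \<le> Suc (3*a + 2*b + 1)" by (cases a) auto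
  qed (auto simp: cone_vertices_def)
  moreover have "(\<lambda>A. ?Q A \<or> 5*a \<in> A \<and> A \<inter> ?N \<noteq> {}) = edge_pred (cone_edges a b)"
  proof
    fix A
    let ?C = "{{x, y} | x y. x \<in> ?K \<and> y \<in> ?K \<and> x \<noteq> y}" and ?A = "{{5*a, v} | v. v \<in> ?V \<and> v \<noteq> 5*a}"
    have "edge_pred ?C A \<longleftrightarrow> (\<exists>x\<in>?K. \<exists>y\<in>?K. x \<noteq> y \<and> {x, y} \<subseteq> A)"
      unfolding edge_pred_def by blast
    moreover have "edge_pred ?A A \<longleftrightarrow> 5*a \<in> A \<and> (\<exists>v\<in>?V. v \<noteq> 5*a \<and> v \<in> A)"
      by (auto simp: edge_pred_def)
    moreover have "A \<inter> ?N \<noteq> {} \<longleftrightarrow> (\<exists>v\<in>?V. v \<noteq> 5*a \<and> v \<in> A)" by blast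
    moreover have "edge_pred (cone_edges a b) A \<longleftrightarrow> ?P a A \<or> edge_pred ?C A \<or> edge_pred ?A A"
      unfolding edge_pred_def cone_edges_def bex_Un by blast
    ultimately show "(?Q A \<or> 5*a \<in> A \<and> A \<inter> ?N \<noteq> {}) = edge_pred (cone_edges a b) A" by blast
  qed
  ultimately show "\<exists>p. corner (edge_pred (cone_edges a b)) (2*a + 1) p" by auto
qed

section \<open>Induced matchings of the cone\<close>

text \<open>Two disjoint edges leave only one vertex of the cycle, so on the other side they are
  joined by an edge of the cycle.\<close>

lemma five_cycle_not_three_disjoint:
  assumes "e \<in> five_cycle k" "e' \<in> five_cycle k" "five_cycle k \<subseteq> E"
  shows "\<not> three_disjoint E e e'"
proof (cases "e \<inter> e' = {}")
  case True
  have "\<exists>f\<in>five_cycle k. f \<inter> e \<noteq> {} \<and> f \<inter> e' \<noteq> {}"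
    using assms(1,2) True unfolding five_cycle_def by (auto simp: insert_commute)
  then show ?thesis using assms(3) by (auto simp: three_disjoint_def)
qed (simp add: three_disjoint_def)

text \<open>An edge at the apex is linked by the apex to every other edge and must be alone. Without
  such an edge, each five-cycle and the clique contribute at most one.\<close>

lemma card_induced_matching_le:
  assumes M: "induced_matching (cone_edges a b) M"
  shows "card M \<le> a + 1"
proof (cases "\<exists>e\<in>M. 5*a \<in> e")
  case True
  then obtain e where e: "e \<in> M" "5*a \<in> e" by blast
  have "e' = e" if "e' \<in> M" for e'
  proof (rule ccontr)
    assume "e' \<noteq> e"
    then have td: "three_disjoint (cone_edges a b) e e'"
      using M e that by (auto simp: induced_matching_def pairwise_def)
    have e': "e' \<in> cone_edges a b" using M that by (auto simp: induced_matching_def)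
    then obtain v where v: "v \<in> e'" using card_cone_edge by fastforce
    then have "v \<noteq> 5*a" using td e(2) by (auto simp: three_disjoint_def)
    then have "{5*a, v} \<in> cone_edges a b" using apex_edge cone_edge_subset[OF e'] v by blast
    then show False using td e(2) v by (auto simp: three_disjoint_def)
  qed
  then have "M = {e}" using e by blast
  then show ?thesis by simp
next
  case False
  let ?C = "{{x, y} | x y. x \<in> clique_vertices a b \<and> y \<in> clique_vertices a b \<and> x \<noteq> y}"
  have fin: "finite M" using M finite_cone_edges finite_subset by (auto simp: induced_matching_def)
  have sub: "M \<subseteq> (\<Union>k<a. M \<inter> five_cycle k) \<union> (M \<inter> ?C)"
  proof
    fix e assume e: "e \<in> M"
    then have "e \<in> cone_edges a b" using M by (auto simp: induced_matching_def)
    then show "e \<in> (\<Union>k<a. M \<inter> five_cycle k) \<union> (M \<inter> ?C)"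
      by (cases rule: cone_edge_cases) (use e False in auto)
  qed
  have le1: "card (M \<inter> B) \<le> 1" if "\<And>e e'. e \<in> B \<Longrightarrow> e' \<in> B \<Longrightarrow> e \<noteq> e' \<Longrightarrow> \<not> three_disjoint (cone_edges a b) e e'" for B
  proof -
    have "e = e'" if "e \<in> M \<inter> B" "e' \<in> M \<inter> B" for e e'
      using that \<open>\<And>e e'. e \<in> B \<Longrightarrow> e' \<in> B \<Longrightarrow> e \<noteq> e' \<Longrightarrow> \<not> three_disjoint (cone_edges a b) e e'\<close> M
      unfolding induced_matching_def pairwise_def by blast
    then show ?thesis using fin by (simp add: card_le_Suc0_iff_eq)
  qed
  have "card (M \<inter> five_cycle k) \<le> 1" if "k < a" for k
    using five_cycle_edge[OF that] by (intro le1 five_cycle_not_three_disjoint) auto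
  then have "(\<Sum>k<a. card (M \<inter> five_cycle k)) \<le> (\<Sum>k<a. 1)" by (intro sum_mono) auto
  moreover have "card (M \<inter> ?C) \<le> 1"
  proof (rule le1)
    fix e e' assume e: "e \<in> ?C" "e' \<in> ?C"
    then obtain x y where xy: "x \<in> e" "y \<in> e'" "x \<in> clique_vertices a b" "y \<in> clique_vertices a b" by blast
    show "\<not> three_disjoint (cone_edges a b) e e'"
    proof (cases "x = y")
      case True
      then show ?thesis using xy by (auto simp: three_disjoint_def)
    next
      case False
      have "\<exists>f\<in>cone_edges a b. f \<inter> e \<noteq> {} \<and> f \<inter> e' \<noteq> {}"
        using xy clique_edge[OF xy(3,4) False] by (intro bexI[of _ "{x, y}"]) auto
      then show ?thesis by (simp add: three_disjoint_def)
    qed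
  qed
  moreover have "card M \<le> card (\<Union>k<a. M \<inter> five_cycle k) + card (M \<inter> ?C)"
    using card_mono[OF _ sub] card_Un_le[of "\<Union>k<a. M \<inter> five_cycle k" "M \<inter> ?C"] fin by auto
  moreover have "card (\<Union>k<a. M \<inter> five_cycle k) \<le> (\<Sum>k<a. card (M \<inter> five_cycle k))"
    by (intro card_UN_le) auto
  ultimately show ?thesis by simp
qed

lemma ind_match_cone: "ind_match (cone_edges a b) = a + 1"
  unfolding ind_match_def
proof (rule Max_eqI)
  show "finite (card ` {M. induced_matching (cone_edges a b) M})"
    using finite_cone_edges[of a b] by (auto simp: induced_matching_def)
  show "n \<le> a + 1" if "n \<in> card ` {M. induced_matching (cone_edges a b) M}" for n
    using that card_induced_matching_le by auto
  \<comment> \<open>One edge from each block; the index \<open>a\<close> stands for the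
    clique.\<close>
  let ?f = "\<lambda>k. if k < a then {5*k, 5*k+1} else {5*a+1, 5*a+2 :: nat}"
  have f: "?f k \<in> cone_edges a b" if "k \<le> a" for k
    using that five_cycle_edge[of k a "{5*k, 5*k+1}" b] clique_edge[of "5*a+1" a b "5*a+2"]
    by (auto simp: five_cycle_def clique_vertices_def)
  have bl: "block a x = k \<and> x \<noteq> 5*a" if "k \<le> a" "x \<in> ?f k" for k x
    using that by (auto simp: block_def min_def split: if_splits)
  have inj: "inj_on ?f {..a}"
  proof (rule inj_onI)
    fix k l assume kl: "k \<in> {..a}" "l \<in> {..a}" "?f k = ?f l"
    have "Min (?f k) \<in> ?f k" by (rule Min_in) auto
    then show "k = l" using bl[of k "Min (?f k)"] bl[of l "Min (?f k)"] kl by (metis atMost_iff)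
  qed
  have im: "induced_matching (cone_edges a b) (?f ` {..a})"
    unfolding induced_matching_def pairwise_def
  proof (intro conjI ballI impI)
    show "?f ` {..a} \<subseteq> cone_edges a b" by (intro image_subsetI f) simp
    fix e e' assume e: "e \<in> ?f ` {..a}" and e': "e' \<in> ?f ` {..a}" and ne: "e \<noteq> e'"
    obtain k where k: "e = ?f k" "k \<in> {..a}" using e by (rule imageE)
    obtain l where l: "e' = ?f l" "l \<in> {..a}" using e' by (rule imageE)
    have kl: "e = ?f k" "e' = ?f l" "k \<le> a" "l \<le> a" "k \<noteq> l" using k l ne by auto
    show "three_disjoint (cone_edges a b) e e'"
      unfolding three_disjoint_def
    proof (intro conjI notI)
      show "e \<inter> e' = {}" using bl kl by blast
      assume "\<exists>g\<in>cone_edges a b. g \<inter> e \<noteq> {} \<and> g \<inter> e' \<noteq> {}"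
      then obtain g x y where "g \<in> cone_edges a b" "x \<in> g" "x \<in> e" "y \<in> g" "y \<in> e'" by blast
      then show False using edge_block[of g a b x y] bl[of k x] bl[of l y] kl by simp
    qed
  qed
  have "a + 1 = card (?f ` {..a})" using card_image[OF inj] by simp
  then show "a + 1 \<in> card ` {M. induced_matching (cone_edges a b) M}" by (rule image_eqI) (rule CollectI, rule im)
qed

section \<open>Maximal matchings of the cone\<close>

text \<open>An edge without matched vertices could be added, so the matched vertices form a vertex
  cover.\<close>

lemma maximal_matching_cover:
  assumes "maximal_matching E M" "e \<in> E" "e \<noteq> {}"
  shows "e \<inter> \<Union>M \<noteq> {}"
proof (cases "e \<in> M")
  case False
  then obtain m where "m \<in> M" "\<not> disjnt e m"
    using assms by (auto simp: maximal_matching_def is_matching_def pairwise_insert disjnt_sym)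
  then show ?thesis by (auto simp: disjnt_def)
qed (use assms in auto)

text \<open>If \<open>v0\<close> is in the cover, the disjoint edges \<open>v1 v2\<close> and
  \<open>v3 v4\<close> each force another vertex; if not, both its neighbours are forced and
  \<open>v2 v3\<close> needs a third vertex.\<close>

lemma card_five_cycle_cover:
  assumes "distinct [v0, v1, v2, v3, v4]" "{v0, v1} \<inter> C \<noteq> {}" "{v1, v2} \<inter> C \<noteq> {}"
    "{v2, v3} \<inter> C \<noteq> {}" "{v3, v4} \<inter> C \<noteq> {}" "{v4, v0} \<inter> C \<noteq> {}"
  shows "3 \<le> card ({v0, v1, v2, v3, v4} \<inter> C)"
proof -
  have 3: "3 \<le> card ({v0, v1, v2, v3, v4} \<inter> C)" if "distinct [x, y, z]" "{x, y, z} \<subseteq> {v0, v1, v2, v3, v4} \<inter> C" for x y z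
    using card_mono[OF _ that(2)] that(1) by simp
  show ?thesis
  proof (cases "v0 \<in> C")
    case True
    have "v1 \<in> C \<or> v2 \<in> C" "v3 \<in> C \<or> v4 \<in> C" using assms by auto
    then show ?thesis using True assms(1) 3[of v0 v1 v3] 3[of v0 v1 v4] 3[of v0 v2 v3] 3[of v0 v2 v4] by auto
  next
    case False
    then have "v1 \<in> C" "v4 \<in> C" "v2 \<in> C \<or> v3 \<in> C" using assms by auto
    then show ?thesis using assms(1) 3[of v1 v4 v2] 3[of v1 v4 v3] by auto
  qed
qed

text \<open>The matched vertices cover all edges, so each five-cycle contains at least 3 and the
  clique at least \<open>2*b + 1\<close> of them. An edge accounts for at most two vertices and
  touches at most one block.\<close>

lemma card_maximal_matching_ge:
  assumes M: "maximal_matching (cone_edges a b) M"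
  shows "2*a + b + 1 \<le> card M"
proof -
  have ME: "M \<subseteq> cone_edges a b" using M by (simp add: maximal_matching_def is_matching_def)
  have fin: "finite M" using ME finite_cone_edges finite_subset by blast
  have cover: "e \<inter> \<Union>M \<noteq> {}" if "e \<in> cone_edges a b" for e
    using maximal_matching_cover[OF M that] card_cone_edge[OF that] by fastforce
  \<comment> \<open>The apex is excluded, so an edge through it is charged only to the block of its
    other end.\<close>
  let ?B = "\<lambda>k. {v. v \<noteq> 5*a \<and> block a v = k}"
  let ?M = "\<lambda>k. {m \<in> M. m \<inter> ?B k \<noteq> {}}"
  have touch: "card (W \<inter> \<Union>M) \<le> 2 * card (?M k)" if W: "W \<subseteq> ?B k" for W k
  proof -
    have "W \<inter> \<Union>M \<subseteq> \<Union>(?M k)" using W by blast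
    have card2: "card m = 2" if "m \<in> ?M k" for m using that ME card_cone_edge by auto
    have "finite m" if "m \<in> ?M k" for m
      using card2[OF that] card.infinite by fastforce
    then have "finite (\<Union>(?M k))" using fin by (intro finite_Union) auto
    then have "card (W \<inter> \<Union>M) \<le> card (\<Union>(?M k))"
      using \<open>W \<inter> \<Union>M \<subseteq> \<Union>(?M k)\<close> by (rule card_mono)
    also have "\<dots> \<le> (\<Sum>m\<in>?M k. card m)" by (rule card_Union_le_sum_card)
    also have "\<dots> = 2 * card (?M k)" using card2 by simp
    finally show ?thesis .
  qed
  have cycles: "2 \<le> card (?M k)" if k: "k < a" for k
  proof -
    have c: "e \<inter> \<Union>M \<noteq> {}" if "e \<in> five_cycle k" for e
      using cover five_cycle_edge[OF k that] by blast
    have "3 \<le> card ({5*k, 5*k+1, 5*k+2, 5*k+3, 5*k+4} \<inter> \<Union>M)"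
      by (rule card_five_cycle_cover) (simp, (rule c, simp add: five_cycle_def)+)
    also have "\<dots> \<le> 2 * card (?M k)"
      using k by (intro touch) (auto simp: block_def min_def)
    finally show ?thesis by simp
  qed
  have clique: "b + 1 \<le> card (?M a)"
  proof -
    let ?K = "clique_vertices a b"
    have finK: "finite ?K" by (simp add: clique_vertices_def)
    have "x = y" if "x \<in> ?K - \<Union>M" "y \<in> ?K - \<Union>M" for x y
      using that cover[OF clique_edge[of x a b y]] by blast
    then have "card (?K - \<Union>M) \<le> 1" using finK by (simp add: card_le_Suc0_iff_eq)
    moreover have "card ?K = card (?K \<inter> \<Union>M) + card (?K - \<Union>M)"
      using finK card_Int_Diff by metis
    moreover have "card ?K = 2*b + 2" by (simp add: clique_vertices_def)
    moreover have "card (?K \<inter> \<Union>M) \<le> 2 * card (?M a)"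
      using block_clique by (intro touch) auto
    \<comment> \<open>An odd number \<open>2*b + 1\<close> of matched vertices needs
      \<open>b + 1\<close> edges.\<close>
    ultimately show ?thesis by linarith
  qed
  have disj: "?M k \<inter> ?M l = {}" if "k \<noteq> l" for k l
    using edge_block ME that by blast
  have "2*a + (b + 1) \<le> (\<Sum>k<a. card (?M k)) + card (?M a)"
    using sum_mono[of "{..<a}" "\<lambda>_. 2" "\<lambda>k. card (?M k)"] cycles clique by simp
  also have "\<dots> = (\<Sum>k\<le>a. card (?M k))" by (simp add: lessThan_Suc_atMost[symmetric])
  also have "\<dots> = card (\<Union>k\<le>a. ?M k)"
    using fin disj by (intro card_UN_disjoint[symmetric]) auto
  also have "\<dots> \<le> card M" using fin by (intro card_mono) auto
  finally show ?thesis by simp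
qed

lemma min_match_cone: "min_match (cone_edges a b) = 2*a + b + 1"
  unfolding min_match_def
proof (rule Min_eqI)
  show "finite (card ` {M. maximal_matching (cone_edges a b) M})"
    using finite_cone_edges[of a b] by (auto simp: maximal_matching_def is_matching_def)
  show "2*a + b + 1 \<le> n" if "n \<in> card ` {M. maximal_matching (cone_edges a b) M}" for n
    using that card_maximal_matching_ge by auto
  text \<open>Left endpoints of the edges of a maximal matching, each edge joining consecutive numbers.\<close>
  define L where "L = (\<lambda>k. 5*k) ` {..<a} \<union> (\<lambda>k. 5*k+2) ` {..<a} \<union> (\<lambda>t. 5*a+2*t) ` {..b}"
  let ?f = "\<lambda>x. {x, x + 1 :: nat}"
  let ?M = "?f ` L"
  have L: "(\<exists>k<a. x = 5*k \<or> x = 5*k+2) \<or> (\<exists>t\<le>b. x = 5*a+2*t)" if "x \<in> L" for x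
    using that unfolding L_def by blast
  \<comment> \<open>Left endpoints are recognised by their residue modulo 5 below the apex and by
    parity from the apex on, so no two are consecutive and the edges are disjoint. The margin 3
    keeps \<open>x + 1\<close> below the apex, where the residue criterion still applies.\<close>
  have res: "x + 3 \<le> 5*a \<and> (x mod 5 = 0 \<or> x mod 5 = 2) \<or> 5*a \<le> x \<and> even (x - 5*a)" if "x \<in> L" for x
  proof -
    from L[OF that] consider k where "k < a" "x = 5*k" | k where "k < a" "x = 5*k+2" | t where "x = 5*a+2*t" by blast
    then show ?thesis
    proof cases
      case 2
      have "x + 3 \<le> 5*a" using 2 by linarith
      moreover have "x mod 5 = 2" using 2(2) by presburger
      ultimately show ?thesis by blast
    qed simp_all
  qed
  have gap: "x + 1 \<noteq> y" if "x \<in> L" "y \<in> L" for x y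
  proof
    assume y: "x + 1 = y"
    from res[OF that(1)] show False
    proof
      assume x: "x + 3 \<le> 5*a \<and> (x mod 5 = 0 \<or> x mod 5 = 2)"
      then have "\<not> 5*a \<le> x + 1" by linarith
      then have "(x + 1) mod 5 = 0 \<or> (x + 1) mod 5 = 2" using res[OF that(2)] unfolding y[symmetric] by linarith
      moreover have "x mod 5 = 0 \<or> x mod 5 = 2" using x by blast
      ultimately show False by presburger
    next
      assume x: "5*a \<le> x \<and> even (x - 5*a)"
      then have "\<not> x + 1 + 3 \<le> 5*a" "x + 1 - 5*a = Suc (x - 5*a)" by linarith+
      then have "even (Suc (x - 5*a))" using res[OF that(2)] unfolding y[symmetric] by metis
      then show False using x even_Suc by blast
    qed
  qed
  have f: "?f x \<in> cone_edges a b" if x: "x \<in> L" for x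
  proof -
    from L[OF x] consider k where "k < a" "x = 5*k \<or> x = 5*k+2" | t where "x = 5*a+2*t" "t \<le> b" by blast
    then show ?thesis
    proof cases
      case 1
      have "?f x = {5*k, 5*k+1} \<or> ?f x = {5*k+2, 5*k+3}"
        using 1(2) by (elim disjE) (simp_all add: numeral_3_eq_3)
      then have "?f x \<in> five_cycle k" unfolding five_cycle_def by blast
      then show ?thesis by (rule five_cycle_edge[OF 1(1)])
    next
      case 2
      show ?thesis
      proof (cases "t = 0")
        case True
        then show ?thesis using 2 apex_edge[of "5*a+1" a b] by (simp add: cone_vertices_def)
      next
        case False
        then show ?thesis using 2 by (intro clique_edge) (auto simp: clique_vertices_def)
      qed
    qed
  qed
  have inj: "inj_on ?f L"
  proof (rule inj_onI)
    fix x y assume "?f x = ?f y"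
    then show "x = y" unfolding doubleton_eq_iff by linarith
  qed
  have "is_matching (cone_edges a b) ?M"
    unfolding is_matching_def
  proof
    show "?M \<subseteq> cone_edges a b" using f by blast
    show "pairwise disjnt ?M"
    proof (rule pairwiseI)
      fix m n assume "m \<in> ?M" "n \<in> ?M" "m \<noteq> n"
      then obtain x y where "m = ?f x" "n = ?f y" "x \<in> L" "y \<in> L" "x \<noteq> y" by blast
      then show "disjnt m n" using gap[of x y] gap[of y x] by (simp add: disjnt_def)
    qed
  qed
  \<comment> \<open>The unmatched vertices are \<open>5*k + 4\<close> for \<open>k < a\<close> and
    the last clique vertex. They are pairwise nonadjacent, and the apex is matched by the edge with
    \<open>t = 0\<close>.\<close>
  moreover have "\<not> is_matching (cone_edges a b) (insert e ?M)" if e: "e \<in> cone_edges a b - ?M" for e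
  proof
    assume "is_matching (cone_edges a b) (insert e ?M)"
    then have "e \<inter> ?f x = {}" if "x \<in> L" for x
    proof -
      have "pairwise disjnt (insert e ?M)"
        using \<open>is_matching (cone_edges a b) (insert e ?M)\<close> by (simp only: is_matching_def)
      moreover have "?f x \<in> insert e ?M" "e \<noteq> ?f x" using that e by blast+
      ultimately show ?thesis using pairwiseD[of disjnt "insert e ?M" e "?f x"] unfolding disjnt_def by blast
    qed
    then have free: "x \<notin> e \<and> x + 1 \<notin> e" if "x \<in> L" for x using that by blast
    have "e \<in> cone_edges a b" using e by blast
    then show False
    proof (cases rule: cone_edge_cases)
      case (1 k)
      then show False using free[of "5*k"] free[of "5*k+2"] by (auto simp: L_def five_cycle_def)
    next
      case (2 x y)
      \<comment> \<open>Any earlier clique vertex is an endpoint of the edge starting at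
        \<open>5*a + 2*(u div 2)\<close>, so a clique edge avoiding the matching would have both
        ends equal.\<close>
      have "z = 5*a+2*b+2" if z: "z \<in> clique_vertices a b" "z \<in> e" for z
      proof (rule ccontr)
        assume "z \<noteq> 5*a+2*b+2"
        then have "5*a \<le> z" "z \<le> 5*a+2*b+1" using z(1) by (auto simp: clique_vertices_def)
        then obtain u where u: "z = 5*a + u" "u \<le> 2*b+1" using le_Suc_ex by (metis add.assoc nat_add_left_cancel_le)
        have "u div 2 \<le> b" using u(2) by linarith
        then have "5*a + 2*(u div 2) \<in> L" unfolding L_def by blast
        moreover have "u = 2*(u div 2) \<or> u = 2*(u div 2) + 1" by presburger
        then have "z = 5*a + 2*(u div 2) \<or> z = 5*a + 2*(u div 2) + 1" using u(1) by linarith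
        ultimately show False using free[of "5*a + 2*(u div 2)"] z(2) by blast
      qed
      then show False using 2 by auto
    next
      case (3 v)
      then show False using free[of "5*a"] by (auto simp: L_def)
    qed
  qed
  ultimately have mm: "maximal_matching (cone_edges a b) ?M" unfolding maximal_matching_def by blast
  have "2*a + b + 1 = card ?M"
  proof -
    have "card L = card ((\<lambda>k. 5*k) ` {..<a} \<union> (\<lambda>k. 5*k+2) ` {..<a}) + card ((\<lambda>t. 5*a+2*t) ` {..b})"
      unfolding L_def by (rule card_Un_disjoint) auto
    also have "card ((\<lambda>k. 5*k) ` {..<a} \<union> (\<lambda>k. 5*k+2) ` {..<a}) = card ((\<lambda>k. 5*k) ` {..<a}) + card ((\<lambda>k. 5*k+2) ` {..<a})"
    proof (rule card_Un_disjoint)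
      have "5*k \<noteq> 5*l + 2" for k l :: nat by presburger
      then show "(\<lambda>k. 5*k) ` {..<a} \<inter> (\<lambda>k. 5*k+2) ` {..<a} = {}" by blast
    qed auto
    finally have "card L = 2*a + b + 1" by (simp add: card_image inj_on_def)
    then show ?thesis using card_image[OF inj] by simp
  qed
  then show "2*a + b + 1 \<in> card ` {M. maximal_matching (cone_edges a b) M}" by (rule image_eqI) (rule CollectI, rule mm)
qed

theorem theorem1p4:
  fixes a b :: nat
  shows "\<exists>(V :: nat set) E. fin_simple_graph V E \<and> connected_graph V E \<and>
    int (ind_match E) =
      regularity V (edge_ring V E :: ((nat, 'k::field) mpoly, _) graded_module) - int a \<and>
    int (min_match E) =
      regularity V (edge_ring V E :: ((nat, 'k) mpoly, _) graded_module) + int b"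
  by (intro exI[of _ "cone_vertices a b"] exI[of _ "cone_edges a b"])
    (simp add: fin_simple_cone connected_cone ind_match_cone min_match_cone regularity_cone)

end
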